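(* Let $g>0$, $\rho_+>\rho_->0$, $[\rho]:=\rho_+-\rho_->0$, $\mu_\pm>0$ and $B\in\mathbb{R}\setminus\{0\}$. For $\xi\in\mathbb{R}$ and $\lambda>0$ consider the problem (vertical magnetic field) of finding $\psi:[-1,1]\to\mathbb{R}$, whose restrictions to $[-1,0]$ and $[0,1]$ are $C^4$, such that on $(-1,0)\cup(0,1)$ $$-\lambda^2\rho(\xi^2\psi-\psi'')=\mu\lambda(\xi^4\psi-2\xi^2\psi''+\psi'''')+|B|^2(-\xi^2\psi''+\psi''''),$$ with the jump conditions $$\llbracket\psi\rrbracket=\llbracket\psi'\rrbracket=0,\qquad \llbracket\mu\lambda(\xi^2\psi+\psi'')+|B|^2\psi''\rrbracket=0,$$ $$\llbracket\mu\lambda(\psi'''-3\xi^2\psi')+|B|^2\psi'''\rrbracket=\llbracket\lambda^2\rho\psi'\rrbracket+g[\rho]\xi^2\psi(0),$$ and the boundary conditions $\psi(-1)=\psi(1)=\psi'(-1)=\psi'(1)=0$. Then: (i) if $|B|\ge|B|_c$, then for every $\xi\in\mathbb{R}$ there is no nontrivial solution $\psi$ with $\lambda>0$; (ii) if $|B|<|B|_c$, then for every $\xi\in\mathbb{R}$ with $|\xi|\le|\xi|_{vc}^B$ there is no nontrivial solution $\psi$ with $\lambda>0$; (iii) if $|B|<|B|_c$, then for every $\xi\in\mathbb{R}$ with $|\xi|>|\xi|^B_{vc}$ there exist $\lambda(\xi)>0$ and a solution $\psi=\psi(\xi,x_2)$ of the problem; moreover $\psi$ and $\lambda$ are even in $\xi$,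 $\psi$ is smooth when restricted to $(-1,0)$ or $(0,1)$, and $\psi(\xi,0)\neq0$.
   Context: Here $\rho(x_2)=\rho_+$ and $\mu(x_2)=\mu_+$ for $x_2\in(0,1)$, $\rho(x_2)=\rho_-$ and $\mu(x_2)=\mu_-$ for $x_2\in(-1,0)$; primes denote $d/dx_2$; for a piecewise function $f$, $\llbracket f\rrbracket:=f(0^+)-f(0^-)$ (limit from $(0,1)$ minus limit from $(-1,0)$). The critical magnetic number is defined by $|B|_c^2:=\sup\{ g[\rho]\psi(0)^2/\int_{-1}^1|\psi'|^2dx_2 : \psi\in H_0^1((-1,1)),\ \psi\ne0\}$. For $|B|<|B|_c$ the critical frequency is defined by $(|\xi|^B_{vc})^2:=\inf\Big\{\frac{|B|^2\int_{-1}^1|\psi''|^2dx_2}{g[\rho]\psi(0)^2-|B|^2\int_{-1}^1|\psi'|^2dx_2}:\ \psi\in H_0^2((-1,1)),\ g[\rho]\psi(0)^2-|B|^2\int_{-1}^1|\psi'|^2dx_2>0\Big\}$. This ODE problem arises from normal-mode solutions $e^{\lambda t}e^{ix_1\xi}$ of the linearized 2D viscous, zero-resistivity MHD two-fluid Rayleigh–Taylor problem in the slab $\mathbb{R}\times(-1,1)$ with heavier fluid on top and constant vertical magnetic field $(0,B)$. *)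

theory Defs
  imports "HOL-Analysis.Analysis"
begin

section \<open>Sobolev classes on (-1,1), via absolutely continuous representatives\<close>

text \<open>dpsi is an L2 weak derivative of psi on [-1,1] and psi vanishes at -1:
  psi x = integral from -1 to x of dpsi, with dpsi square integrable.\<close>
definition L2_antideriv :: "(real \<Rightarrow> real) \<Rightarrow> (real \<Rightarrow> real) \<Rightarrow> bool" where
  "L2_antideriv psi dpsi \<longleftrightarrow>
     dpsi measurable_on {-1..1} \<and> (\<lambda>x. (dpsi x)^2) integrable_on {-1..1} \<and>
     (\<forall>x\<in>{-1..1}. psi x = integral {-1..x} dpsi)"

definition H01 :: "(real \<Rightarrow> real) \<Rightarrow> (real \<Rightarrow> real) \<Rightarrow> bool" where
  "H01 psi dpsi \<longleftrightarrow> L2_antideriv psi dpsi \<and> psi 1 = 0"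

definition H02 :: "(real \<Rightarrow> real) \<Rightarrow> (real \<Rightarrow> real) \<Rightarrow> (real \<Rightarrow> real) \<Rightarrow> bool" where
  "H02 psi d1 d2 \<longleftrightarrow> H01 psi d1 \<and> H01 d1 d2"

definition nonzero_on :: "(real \<Rightarrow> real) \<Rightarrow> bool" where
  "nonzero_on psi \<longleftrightarrow> (\<exists>x\<in>{-1..1}. psi x \<noteq> 0)"

text \<open>|B|_c (the square root of the supremum defining |B|_c^2); grho = g[rho].\<close>
definition Bcrit :: "real \<Rightarrow> real" where
  "Bcrit grho = sqrt (Sup {grho * (psi 0)^2 / integral {-1..1} (\<lambda>x. (dpsi x)^2) |
        psi dpsi. H01 psi dpsi \<and> nonzero_on psi})"

definition xi_vc :: "real \<Rightarrow> real \<Rightarrow> real" where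
  "xi_vc grho B = sqrt (Inf {B^2 * integral {-1..1} (\<lambda>x. (d2 x)^2) /
        (grho * (psi 0)^2 - B^2 * integral {-1..1} (\<lambda>x. (d1 x)^2)) |
        psi d1 d2. H02 psi d1 d2 \<and>
          grho * (psi 0)^2 - B^2 * integral {-1..1} (\<lambda>x. (d1 x)^2) > 0})"

definition C4_on :: "real \<Rightarrow> real \<Rightarrow> (real \<Rightarrow> real) \<Rightarrow> (nat \<Rightarrow> real \<Rightarrow> real) \<Rightarrow> bool" where
  "C4_on a b f D \<longleftrightarrow> (\<forall>x\<in>{a..b}. D 0 x = f x) \<and>
     (\<forall>k<4. \<forall>x\<in>{a..b}. (D k has_real_derivative D (Suc k) x) (at x within {a..b})) \<and>
     continuous_on {a..b} (D 4)"

definition smooth_on :: "real set \<Rightarrow> (real \<Rightarrow> real) \<Rightarrow> bool" where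
  "smooth_on S f \<longleftrightarrow> (\<exists>D. (\<forall>x\<in>S. D 0 x = f x) \<and>
     (\<forall>k. \<forall>x\<in>S. (D k has_real_derivative D (Suc k) x) (at x)))"

definition ode_res :: "real \<Rightarrow> real \<Rightarrow> real \<Rightarrow> real \<Rightarrow> real \<Rightarrow> (nat \<Rightarrow> real) \<Rightarrow> bool" where
  "ode_res rho mu B xi lm d \<longleftrightarrow>
     - (lm^2 * rho * (xi^2 * d 0 - d 2)) =
       mu * lm * (xi^4 * d 0 - 2 * xi^2 * d 2 + d 4) + \<bar>B\<bar>^2 * (d 4 - xi^2 * d 2)"

text \<open>psi solves the vertical-field problem with parameters g, rho_+, rho_-, mu_+, mu_-, B,
  wavenumber xi and growth rate lm.  Dm / Dp are the derivatives of the restrictions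
  to [-1,0] / [0,1]; jumps are (value from (0,1)) minus (value from (-1,0)) at 0.\<close>
definition is_solution ::
  "real \<Rightarrow> real \<Rightarrow> real \<Rightarrow> real \<Rightarrow> real \<Rightarrow> real \<Rightarrow> real \<Rightarrow> real \<Rightarrow> (real \<Rightarrow> real) \<Rightarrow> bool" where
  "is_solution g rp rm mp mm B xi lm psi \<longleftrightarrow>
    (\<exists>Dm Dp. C4_on (-1) 0 psi Dm \<and> C4_on 0 1 psi Dp \<and>
      (\<forall>x\<in>{-1<..<0}. ode_res rm mm B xi lm (\<lambda>k. Dm k x)) \<and>
      (\<forall>x\<in>{0<..<1}. ode_res rp mp B xi lm (\<lambda>k. Dp k x)) \<and>
      Dp 0 0 - Dm 0 0 = 0 \<and>
      Dp 1 0 - Dm 1 0 = 0 \<and>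
      (mp * lm * (xi^2 * Dp 0 0 + Dp 2 0) + \<bar>B\<bar>^2 * Dp 2 0)
        - (mm * lm * (xi^2 * Dm 0 0 + Dm 2 0) + \<bar>B\<bar>^2 * Dm 2 0) = 0 \<and>
      (mp * lm * (Dp 3 0 - 3 * xi^2 * Dp 1 0) + \<bar>B\<bar>^2 * Dp 3 0)
        - (mm * lm * (Dm 3 0 - 3 * xi^2 * Dm 1 0) + \<bar>B\<bar>^2 * Dm 3 0)
        = (lm^2 * rp * Dp 1 0 - lm^2 * rm * Dm 1 0) + g * (rp - rm) * xi^2 * psi 0 \<and>
      psi (-1) = 0 \<and> psi 1 = 0 \<and> Dm 1 (-1) = 0 \<and> Dp 1 1 = 0)"

end

theory Submission
  imports Defs
begin

text \<open>Testing the equation with a function h in H_0^2 gives the weak form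
  N(psi, h) = g [rho] xi^2 psi(0) h(0), where N(h) = lm^2 J(h) + lm V(h) + P(h) with J, V, P nonnegative
  and P(h) = B^2 (int |h''|^2 + xi^2 int |h'|^2). For h = psi this reads N(psi) = g [rho] xi^2 psi(0)^2.
  In the cases (i) and (ii) the right-hand side is at most P(psi), so J(psi) = 0 and psi vanishes.

  For (iii), let Phi be the solution of the problem in which the last jump is prescribed to be 1; it
  exists for every lm > 0, since this is a square linear system for the Cauchy data at 0 whose kernel is
  trivial by the energy identity. Then N(Phi, h) = h(0), so v(lm) := Phi(0) is the maximum of
  h(0)^2 / N(h). As N is increasing in lm and N / lm^2 is decreasing, v is decreasing and lm^2 v is
  increasing, hence v is continuous. It exceeds 1 / (g [rho] xi^2) for small lm because |xi| > |xi|_vc,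
  and it tends to 0 for large lm. Where it equals 1 / (g [rho] xi^2), Phi, which is nonzero at 0, solves
  the original problem.\<close>

section \<open>Integration by parts and square integrable derivatives\<close>

text \<open>The growth rate enters linearly through viscosity and quadratically through inertia, so
  it is not directly the extremal value of a quadratic quotient; the usual detour freezes one
  occurrence, minimises and then solves a fixed point equation. Prescribing the jump makes
  \<open>lm\<close> a free parameter instead. Each problem is then linear algebra in dimension 8:
  neither compactness in H_0^2 nor regularity of minimisers is called for, and smoothness comes from
  power series. Functions of H_0^2 serve only as test functions, but there they cannot be avoided:
  the function that witnesses |xi| > |xi|_vc comes from an infimum and has merely a square
  integrable second derivative. Hence the weak form rests on an integration by parts for absolutely
  continuous functions. Continuity of v is drawn from its two monotonicities alone, without
  continuous dependence of the solutions on \<open>lm\<close>.\<close>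

lemma absolutely_integrable_continuous_mult:
  fixes f F :: "real \<Rightarrow> real"
  assumes "continuous_on {a..b} F" "f absolutely_integrable_on {a..b}"
  shows "(\<lambda>x. F x * f x) absolutely_integrable_on {a..b}"
  using assms
  by (intro absolutely_integrable_bounded_measurable_product_real)
     (auto intro: continuous_imp_measurable_on_sets_lebesgue compact_imp_bounded compact_continuous_image)

lemma has_integral_deriv_subinterval:
  fixes F F' :: "real \<Rightarrow> real"
  assumes "\<And>t. t \<in> {a..b} \<Longrightarrow> (F has_real_derivative F' t) (at t within {a..b})"
    and "a \<le> x" "x \<le> y" "y \<le> b"
  shows "(F' has_integral (F y - F x)) {x..y}"
proof (rule fundamental_theorem_of_calculus)
  fix t assume "t \<in> {x..y}"
  then have "(F has_real_derivative F' t) (at t within {x..y})"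
    using assms by (intro DERIV_subset[OF assms(1)]) auto
  then show "(F has_vector_derivative F' t) (at t within {x..y})"
    by (simp add: has_real_derivative_iff_has_vector_derivative)
qed fact

text \<open>Here u is merely absolutely continuous, so the product rule is unavailable pointwise. Instead, the
  defect of the formula over a short interval [x,y] is at most e times the integral of |f| + |F'|;
  these bounds add up over adjacent intervals, hence hold on the whole interval for every e.\<close>
lemma has_integral_by_parts_antideriv:
  fixes f u F F' :: "real \<Rightarrow> real"
  assumes ab: "a \<le> b" and f: "f absolutely_integrable_on {a..b}"
    and u: "\<And>x y. a \<le> x \<Longrightarrow> x \<le> y \<Longrightarrow> y \<le> b \<Longrightarrow> u y = u x + integral {x..y} f"
    and F: "\<And>x. x \<in> {a..b} \<Longrightarrow> (F has_real_derivative F' x) (at x within {a..b})"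
    and F': "continuous_on {a..b} F'"
  shows "((\<lambda>x. F x * f x + F' x * u x) has_integral F b * u b - F a * u a) {a..b}"
proof -
  have cF: "continuous_on {a..b} F" using F by (meson DERIV_continuous_on)
  have fi: "f integrable_on {a..b}" using f absolutely_integrable_on_def by blast
  have u': "u x = u a + integral {a..x} f" if "x \<in> {a..b}" for x using u[of a x] that by auto
  have cu: "continuous_on {a..b} u"
    by (subst continuous_on_cong[OF refl u']) (auto intro!: continuous_intros indefinite_integral_continuous_1 fi)
  define w where "w x = F x * f x + F' x * u x" for x
  define v where "v x = \<bar>f x\<bar> + \<bar>F' x\<bar>" for x
  have Ff: "(\<lambda>x. F x * f x) integrable_on {a..b}"
    using absolutely_integrable_continuous_mult[OF cF f] absolutely_integrable_on_def by blast
  have F'u: "(\<lambda>x. F' x * u x) integrable_on {a..b}"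
    by (intro integrable_continuous_real continuous_intros F' cu)
  have wi: "w integrable_on {a..b}" unfolding w_def by (intro integrable_add Ff F'u)
  have vi: "v integrable_on {a..b}" unfolding v_def
    using f integrable_continuous_real[OF continuous_on_rabs[OF F']]
    by (intro integrable_add) (auto simp: absolutely_integrable_on_def)
  define H where "H x y = F y * u y - F x * u x - integral {x..y} w" for x y
  have key: "\<bar>H a b\<bar> \<le> e * integral {a..b} v" if e: "e > 0" for e
  proof -
    define P where "P x y \<longleftrightarrow> (a \<le> x \<and> y \<le> b \<longrightarrow> \<bar>H x y\<bar> \<le> e * integral {x..y} v)" for x y
    have "P a b"
      using ab
    proof (induct rule: Bolzano)
      case (trans x y z)
      show ?case unfolding P_def
      proof safe
        assume *: "a \<le> x" "z \<le> b"
        have w: "integral {x..z} w = integral {x..y} w + integral {y..z} w"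
          using * trans by (intro Henstock_Kurzweil_Integration.integral_combine[symmetric] integrable_on_subinterval[OF wi]) auto
        have v: "integral {x..z} v = integral {x..y} v + integral {y..z} v"
          using * trans by (intro Henstock_Kurzweil_Integration.integral_combine[symmetric] integrable_on_subinterval[OF vi]) auto
        have "H x z = H x y + H y z" unfolding H_def w by simp
        then show "\<bar>H x z\<bar> \<le> e * integral {x..z} v"
          unfolding v using trans * unfolding P_def by (auto simp: algebra_simps)
      qed
    next
      case (local z)
      obtain d1 where d1: "d1 > 0" "\<And>t. t \<in> {a..b} \<Longrightarrow> \<bar>t - z\<bar> < d1 \<Longrightarrow> \<bar>F t - F z\<bar> < e / 2"
        using cF local e unfolding continuous_on_iff dist_real_def by (metis atLeastAtMost_iff half_gt_zero)
      obtain d2 where d2: "d2 > 0" "\<And>t. t \<in> {a..b} \<Longrightarrow> \<bar>t - z\<bar> < d2 \<Longrightarrow> \<bar>u t - u z\<bar> < e / 2"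
        using cu local e unfolding continuous_on_iff dist_real_def by (metis atLeastAtMost_iff half_gt_zero)
      show ?case
      proof (intro exI[of _ "min d1 d2"] conjI allI impI)
        fix x y assume xy: "x \<le> z \<and> z \<le> y \<and> y - x < min d1 d2"
        show "P x y" unfolding P_def
        proof safe
          assume *: "a \<le> x" "y \<le> b"
          then have sub: "{x..y} \<subseteq> {a..b}" by auto
          have Ft: "\<bar>F y - F t\<bar> \<le> e" if "t \<in> {x..y}" for t
          proof -
            have "\<bar>t - z\<bar> < d1" "\<bar>y - z\<bar> < d1" "t \<in> {a..b}" "y \<in> {a..b}" using that xy * by auto
            then show ?thesis using d1(2)[of t] d1(2)[of y] by linarith
          qed
          have ut: "\<bar>u x - u t\<bar> \<le> e" if "t \<in> {x..y}" for t
          proof -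
            have "\<bar>t - z\<bar> < d2" "\<bar>x - z\<bar> < d2" "t \<in> {a..b}" "x \<in> {a..b}" using that xy * by auto
            then show ?thesis using d2(2)[of t] d2(2)[of x] by linarith
          qed
          \<comment> \<open>Freezing \<open>F\<close> at the right end and \<open>u\<close> at the
            left end makes the product rule exact: F y (u y - u x) + u x (F y - F x) = F y u y - F x
            u x.\<close>
          have f1: "((\<lambda>t. F y * f t) has_integral F y * (u y - u x)) {x..y}"
          proof -
            have "(f has_integral integral {x..y} f) {x..y}"
              using integrable_on_subinterval[OF fi sub] by blast
            moreover have "integral {x..y} f = u y - u x" using u[of x y] xy * by simp
            ultimately show ?thesis using has_integral_mult_right by metis
          qed
          have "(F' has_integral (F y - F x)) {x..y}"
            using xy * by (intro has_integral_deriv_subinterval[OF F]) auto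
          then have f2: "((\<lambda>t. u x * F' t) has_integral u x * (F y - F x)) {x..y}"
            by (rule has_integral_mult_right)
          have f3: "(w has_integral integral {x..y} w) {x..y}"
            using integrable_on_subinterval[OF wi sub] by blast
          have D: "((\<lambda>t. F y * f t + u x * F' t - w t) has_integral H x y) {x..y}"
            using has_integral_diff[OF has_integral_add[OF f1 f2] f3]
            by (simp add: H_def algebra_simps)
          have V: "((\<lambda>t. e * v t) has_integral e * integral {x..y} v) {x..y}"
            using integrable_on_subinterval[OF vi sub] by (intro has_integral_mult_right) blast
          have bnd: "norm (F y * f t + u x * F' t - w t) \<le> e * v t" if "t \<in> {x..y}" for t
          proof -
            have "F y * f t + u x * F' t - w t = (F y - F t) * f t + (u x - u t) * F' t"
              by (simp add: w_def algebra_simps)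
            also have "norm \<dots> \<le> \<bar>F y - F t\<bar> * \<bar>f t\<bar> + \<bar>u x - u t\<bar> * \<bar>F' t\<bar>"
              by (metis abs_mult abs_triangle_ineq real_norm_def)
            also have "\<dots> \<le> e * \<bar>f t\<bar> + e * \<bar>F' t\<bar>"
              using Ft[OF that] ut[OF that] by (intro add_mono mult_right_mono) auto
            finally show ?thesis by (simp add: v_def algebra_simps)
          qed
          have "norm (integral {x..y} (\<lambda>t. F y * f t + u x * F' t - w t)) \<le> integral {x..y} (\<lambda>t. e * v t)"
            by (rule integral_norm_bound_integral) (use D V bnd in auto)
          then show "\<bar>H x y\<bar> \<le> e * integral {x..y} v"
            using D V by (simp add: integral_unique)
        qed
      qed (use d1 d2 in auto)
    qed
    then show ?thesis unfolding P_def by simp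
  qed
  have "H a b = 0"
  proof (rule ccontr)
    assume n: "H a b \<noteq> 0"
    define V where "V = integral {a..b} v"
    have V: "V \<ge> 0" unfolding V_def by (intro Henstock_Kurzweil_Integration.integral_nonneg vi) (auto simp: v_def)
    \<comment> \<open>With this e the bound e V falls strictly below |H a b|; the summand 1 takes
      care of V = 0.\<close>
    have "\<bar>H a b\<bar> \<le> \<bar>H a b\<bar> / (2 * (V + 1)) * V"
      using key[of "\<bar>H a b\<bar> / (2 * (V + 1))"] n V unfolding V_def[symmetric] by auto
    also have "\<dots> < \<bar>H a b\<bar>" using n V by (simp add: divide_simps)
    finally show False by simp
  qed
  then show ?thesis using wi unfolding H_def w_def by (metis eq_iff_diff_eq_0 integrable_integral)
qed

text \<open>Cauchy-Schwarz against the constant 1: the integral of (f - c)^2 is nonnegative, with c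
  the mean of \<open>f\<close>.\<close>

lemma square_integral_le:
  fixes f :: "real \<Rightarrow> real"
  assumes ab: "a \<le> b" and f: "f integrable_on {a..b}" and f2: "(\<lambda>x. (f x)\<^sup>2) integrable_on {a..b}"
  shows "(integral {a..b} f)\<^sup>2 \<le> (b - a) * integral {a..b} (\<lambda>x. (f x)\<^sup>2)"
proof (cases "a = b")
  case False
  define I J c where "I = integral {a..b} f" "J = integral {a..b} (\<lambda>x. (f x)\<^sup>2)" "c = I / (b - a)"
  have "((\<lambda>x. (f x)\<^sup>2 - 2 * c * f x + c\<^sup>2) has_integral J - 2 * c * I + (b - a) * c\<^sup>2) {a..b}"
    using f f2 has_integral_const_real[of "c\<^sup>2" a b] ab unfolding I_J_c_def
    by (intro has_integral_add has_integral_diff has_integral_mult_right) auto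
  then have "0 \<le> J - 2 * c * I + (b - a) * c\<^sup>2"
  proof (rule has_integral_nonneg)
    fix x have "(f x)\<^sup>2 - 2 * c * f x + c\<^sup>2 = (f x - c)\<^sup>2" by (simp add: power2_eq_square algebra_simps)
    then show "0 \<le> (f x)\<^sup>2 - 2 * c * f x + c\<^sup>2" by simp
  qed
  also have "\<dots> = J - I\<^sup>2 / (b - a)"
  proof -
    have "(b - a) * c = I" using False by (simp add: I_J_c_def(3))
    then have "J - 2 * c * I + (b - a) * c\<^sup>2 = J - c * I" by (simp add: power2_eq_square flip: mult.assoc)
    then show ?thesis by (simp add: I_J_c_def(3) power2_eq_square)
  qed
  finally show ?thesis using False ab unfolding I_J_c_def(1,2) by (simp add: field_simps)
qed auto

lemma L2_absolutely_integrable: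
  fixes f :: "real \<Rightarrow> real"
  assumes "f measurable_on {a..b}" "(\<lambda>x. (f x)\<^sup>2) integrable_on {a..b}"
  shows "f absolutely_integrable_on {a..b}"
proof (rule measurable_bounded_by_integrable_imp_absolutely_integrable)
  show "f \<in> borel_measurable (lebesgue_on {a..b})"
    using assms(1) by (simp add: measurable_on_iff_borel_measurable)
  show "(\<lambda>x. 1 + (f x)\<^sup>2) integrable_on {a..b}"
    using assms(2) by (intro integrable_add) auto
  show "norm (f x) \<le> 1 + (f x)\<^sup>2" for x
    using zero_le_power2[of "\<bar>f x\<bar> - 1"] by (simp add: power2_diff)
qed simp

lemma L2_antiderivD:
  assumes "L2_antideriv u f"
  shows "f absolutely_integrable_on {-1..1}" "f integrable_on {-1..1}"
    "(\<lambda>x. (f x)\<^sup>2) integrable_on {-1..1}"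
    "-1 \<le> x \<Longrightarrow> x \<le> y \<Longrightarrow> y \<le> 1 \<Longrightarrow> u y = u x + integral {x..y} f"
    "continuous_on {-1..1} u" "u (-1) = 0"
proof -
  show f: "f absolutely_integrable_on {-1..1}"
    using assms L2_absolutely_integrable unfolding L2_antideriv_def by blast
  then show fi: "f integrable_on {-1..1}" by (auto simp: absolutely_integrable_on_def)
  show "(\<lambda>x. (f x)\<^sup>2) integrable_on {-1..1}" using assms unfolding L2_antideriv_def by blast
  have u: "u x = integral {-1..x} f" if "x \<in> {-1..1}" for x
    using assms that unfolding L2_antideriv_def by blast
  show "u y = u x + integral {x..y} f" if "-1 \<le> x" "x \<le> y" "y \<le> 1"
    using that u[of x] u[of y]
      Henstock_Kurzweil_Integration.integral_combine[of "-1" x y f] integrable_on_subinterval[OF fi, of "-1" y]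
    by auto
  show "continuous_on {-1..1} u"
    by (subst continuous_on_cong[OF refl u]) (auto intro!: indefinite_integral_continuous_1 fi)
  show "u (-1) = 0" using u[of "-1"] by simp
qed

text \<open>A kink at 0 is harmless because a single point does not affect integrals; accordingly
  \<open>f\<close> is left free there. This is how the glued solutions and the smoothed tents enter
  the Sobolev classes.\<close>

lemma L2_antideriv_piecewise:
  assumes um: "\<And>x. x \<in> {-1..0} \<Longrightarrow> (um has_real_derivative fm x) (at x within {-1..0})"
    and up: "\<And>x. x \<in> {0..1} \<Longrightarrow> (up has_real_derivative fp x) (at x within {0..1})"
    and fm: "continuous_on {-1..0} fm" and fp: "continuous_on {0..1} fp"
    and match: "um 0 = up 0" and bd: "um (-1) = 0"
    and u: "\<And>x. x \<in> {-1..0} \<Longrightarrow> u x = um x" "\<And>x. x \<in> {0..1} \<Longrightarrow> u x = up x"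
    and f: "\<And>x. x \<in> {-1..<0} \<Longrightarrow> f x = fm x" "\<And>x. x \<in> {0<..1} \<Longrightarrow> f x = fp x"
  shows "L2_antideriv u f"
proof -
  have spm: "(f has_integral I) {-1..x}" if "x \<le> 0" "(fm has_integral I) {-1..x}" for x I
    by (rule has_integral_spike_finite[of "{0}" _ f fm]) (use that f(1) in auto)
  have spp: "(f has_integral I) {0..x}" if "x \<le> 1" "(fp has_integral I) {0..x}" for x I
    by (rule has_integral_spike_finite[of "{0}" _ f fp]) (use that f(2) in auto)
  have Im: "(f has_integral um x) {-1..x}" if "x \<in> {-1..0}" for x
  proof (rule spm)
    show "x \<le> 0" using that by simp
    have "(fm has_integral um x - um (-1)) {-1..x}"
      using that by (intro has_integral_deriv_subinterval[OF um]) auto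
    then show "(fm has_integral um x) {-1..x}" using bd by simp
  qed
  have Ip: "(f has_integral up x - up 0) {0..x}" if "x \<in> {0..1}" for x
  proof (rule spp)
    show "x \<le> 1" using that by simp
    show "(fp has_integral up x - up 0) {0..x}"
      using that by (intro has_integral_deriv_subinterval[OF up]) auto
  qed
  have I: "(f has_integral u x) {-1..x}" if "x \<in> {-1..1}" for x
  proof (cases "x \<le> 0")
    case True
    then show ?thesis using Im[of x] u(1)[of x] that by auto
  next
    case False
    have "(f has_integral um 0 + (up x - up 0)) {-1..x}"
      by (rule has_integral_combine[OF _ _ Im Ip]) (use False that in auto)
    then show ?thesis using match u(2)[of x] False that by auto
  qed
  have sq: "(\<lambda>x. (f x)\<^sup>2) integrable_on {-1..1}"
  proof (rule Henstock_Kurzweil_Integration.integrable_combine[where a="-1" and c=0 and b=1])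
    show "(\<lambda>x. (f x)\<^sup>2) integrable_on {-1..0}"
      by (rule integrable_spike_finite[of "{0}" _ _ "\<lambda>x. (fm x)\<^sup>2"])
         (auto intro!: integrable_continuous_real continuous_intros fm simp: f)
    show "(\<lambda>x. (f x)\<^sup>2) integrable_on {0..1}"
      by (rule integrable_spike_finite[of "{0}" _ _ "\<lambda>x. (fp x)\<^sup>2"])
         (auto intro!: integrable_continuous_real continuous_intros fp simp: f)
  qed auto
  have "f measurable_on {-1..1}"
  proof -
    have "f integrable_on {-1..1}" using I[of 1] by auto
    then have "f \<in> borel_measurable (lebesgue_on {-1..1})"
      using integrable_imp_measurable by blast
    then show ?thesis by (simp add: measurable_on_iff_borel_measurable)
  qed
  then show ?thesis unfolding L2_antideriv_def using sq I integral_unique by metis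
qed

lemma H02D:
  assumes "H02 h h1 h2"
  shows "L2_antideriv h h1" "L2_antideriv h1 h2" "h (-1) = 0" "h 1 = 0" "h1 (-1) = 0" "h1 1 = 0"
    "continuous_on {-1..1} h" "continuous_on {-1..1} h1"
  using assms L2_antiderivD(5,6) unfolding H02_def H01_def by auto

section \<open>The energy and the weak form\<close>

text \<open>For j >= 2 the one-sided values at 0 may differ, and the left one is taken. Integrals
  over {0..1} are therefore compared away from the point 0.\<close>

definition glue :: "(nat \<Rightarrow> real \<Rightarrow> real) \<Rightarrow> (nat \<Rightarrow> real \<Rightarrow> real) \<Rightarrow> nat \<Rightarrow> real \<Rightarrow> real" where
  "glue Dm Dp j x = (if x \<le> 0 then Dm j x else Dp j x)"

locale rayleigh_taylor =
  fixes rp rm mp mm B xi :: real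
  assumes rm_pos: "rm > 0" and rp_gt: "rp > rm" and mp_pos: "mp > 0" and mm_pos: "mm > 0"
begin

text \<open>The viscous part is xi^2 / 2 times |grad v + (grad v)^T|^2 for the divergence-free mode
  v = (i psi' / xi, psi) e^(i x1 xi). Unlike xi^4 psi^2 + 2 xi^2 psi'^2 + psi''^2, which leads to
  the same equation, it has the prescribed viscous jumps as its natural interface
  conditions.\<close>

definition energy_density :: "real \<Rightarrow> real \<Rightarrow> real \<Rightarrow> real \<Rightarrow> real \<Rightarrow> real \<Rightarrow> real" where
  "energy_density rho mu lm u0 u1 u2 =
     lm^2 * rho * (xi^2 * u0^2 + u1^2) + lm * mu * ((xi^2 * u0 + u2)^2 + 4 * xi^2 * u1^2)
     + B^2 * (u2^2 + xi^2 * u1^2)"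

definition polar ::
  "real \<Rightarrow> real \<Rightarrow> real \<Rightarrow> real \<Rightarrow> real \<Rightarrow> real \<Rightarrow> real \<Rightarrow> real \<Rightarrow> real \<Rightarrow> real" where
  "polar rho mu lm u0 u1 u2 v0 v1 v2 =
     lm^2 * rho * (xi^2 * u0 * v0 + u1 * v1)
     + lm * mu * ((xi^2 * u0 + u2) * (xi^2 * v0 + v2) + 4 * xi^2 * u1 * v1)
     + B^2 * (u2 * v2 + xi^2 * u1 * v1)"

definition energy :: "real \<Rightarrow> (real \<Rightarrow> real) \<Rightarrow> (real \<Rightarrow> real) \<Rightarrow> (real \<Rightarrow> real) \<Rightarrow> real" where
  "energy lm h h1 h2 = integral {-1..0} (\<lambda>x. energy_density rm mm lm (h x) (h1 x) (h2 x))
     + integral {0..1} (\<lambda>x. energy_density rp mp lm (h x) (h1 x) (h2 x))"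

text \<open>The boundary value problem with the last jump, which is g [rho] xi^2 psi(0) in the eigenvalue
  problem, replaced by a prescribed number k.\<close>
definition transmission ::
  "real \<Rightarrow> real \<Rightarrow> (nat \<Rightarrow> real \<Rightarrow> real) \<Rightarrow> (nat \<Rightarrow> real \<Rightarrow> real) \<Rightarrow> bool" where
  "transmission lm k Dm Dp \<longleftrightarrow>
     (\<forall>j<4. \<forall>x\<in>{-1..0}. (Dm j has_real_derivative Dm (Suc j) x) (at x within {-1..0})) \<and>
     (\<forall>j<4. \<forall>x\<in>{0..1}. (Dp j has_real_derivative Dp (Suc j) x) (at x within {0..1})) \<and>
     continuous_on {-1..0} (Dm 4) \<and> continuous_on {0..1} (Dp 4) \<and>
     (\<forall>x\<in>{-1<..<0}. ode_res rm mm B xi lm (\<lambda>k. Dm k x)) \<and>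
     (\<forall>x\<in>{0<..<1}. ode_res rp mp B xi lm (\<lambda>k. Dp k x)) \<and>
     Dp 0 0 - Dm 0 0 = 0 \<and> Dp 1 0 - Dm 1 0 = 0 \<and>
     (mp * lm * (xi^2 * Dp 0 0 + Dp 2 0) + B^2 * Dp 2 0)
       - (mm * lm * (xi^2 * Dm 0 0 + Dm 2 0) + B^2 * Dm 2 0) = 0 \<and>
     (mp * lm * (Dp 3 0 - 3 * xi^2 * Dp 1 0) + B^2 * Dp 3 0)
       - (mm * lm * (Dm 3 0 - 3 * xi^2 * Dm 1 0) + B^2 * Dm 3 0)
       - (lm^2 * rp * Dp 1 0 - lm^2 * rm * Dm 1 0) = k \<and>
     Dm 0 (-1) = 0 \<and> Dp 0 1 = 0 \<and> Dm 1 (-1) = 0 \<and> Dp 1 1 = 0"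

lemma energy_density_nonneg: "rho \<ge> 0 \<Longrightarrow> mu \<ge> 0 \<Longrightarrow> lm \<ge> 0 \<Longrightarrow> energy_density rho mu lm u0 u1 u2 \<ge> 0"
  unfolding energy_density_def by (intro add_nonneg_nonneg mult_nonneg_nonneg) auto

text \<open>The polar form of the energy density is c0 h + c1 h' + c2 h'', where the coefficients depend on
  the first argument only, and the differential equation reads c0 - c1' + c2'' = 0; so the polar form is
  the derivative of P = c2 h' + (c1 - c2') h.\<close>
lemma polar_half:
  assumes ab: "a < b"
    and D: "\<And>j x. j < 4 \<Longrightarrow> x \<in> {a..b} \<Longrightarrow> (D j has_real_derivative D (Suc j) x) (at x within {a..b})"
    and D4: "continuous_on {a..b} (D 4)"
    and ode: "\<And>x. x \<in> {a<..<b} \<Longrightarrow> ode_res rho mu B xi lm (\<lambda>k. D k x)"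
    and h2: "h2 absolutely_integrable_on {a..b}"
    and h1: "\<And>x y. a \<le> x \<Longrightarrow> x \<le> y \<Longrightarrow> y \<le> b \<Longrightarrow> h1 y = h1 x + integral {x..y} h2"
    and h: "\<And>x y. a \<le> x \<Longrightarrow> x \<le> y \<Longrightarrow> y \<le> b \<Longrightarrow> h y = h x + integral {x..y} h1"
    and h1c: "continuous_on {a..b} h1"
    and P: "\<And>x. P x = (mu * lm * (xi^2 * D 0 x + D 2 x) + B^2 * D 2 x) * h1 x
      + (lm^2 * rho * D 1 x - (mu * lm * (D 3 x - 3 * xi^2 * D 1 x) + B^2 * D 3 x) + B^2 * xi^2 * D 1 x) * h x"
  shows "((\<lambda>x. polar rho mu lm (D 0 x) (D 1 x) (D 2 x) (h x) (h1 x) (h2 x)) has_integral P b - P a) {a..b}"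
proof -
  have d: "(D 0 has_real_derivative D 1 x) (at x within {a..b})"
    "(D 1 has_real_derivative D 2 x) (at x within {a..b})"
    "(D 2 has_real_derivative D 3 x) (at x within {a..b})"
    "(D 3 has_real_derivative D 4 x) (at x within {a..b})" if "x \<in> {a..b}" for x
    using D[of 0 x] D[of 1 x] D[of 2 x] D[of 3 x] that by (auto simp: numeral_eq_Suc)
  have c: "continuous_on {a..b} (D 0)" "continuous_on {a..b} (D 1)" "continuous_on {a..b} (D 2)" "continuous_on {a..b} (D 3)"
    using d by (meson DERIV_continuous_on)+
  define c2 where "c2 x = mu * lm * (xi^2 * D 0 x + D 2 x) + B^2 * D 2 x" for x
  define c2' where "c2' x = mu * lm * (xi^2 * D 1 x + D 3 x) + B^2 * D 3 x" for x
  \<comment> \<open>This \<open>c1\<close> is the combination called c1 - c2' above, so that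
    \<open>P\<close> equals \<open>c2\<close> h' + \<open>c1\<close> h.\<close>
  define c1 where "c1 x = lm^2 * rho * D 1 x - (mu * lm * (D 3 x - 3 * xi^2 * D 1 x) + B^2 * D 3 x) + B^2 * xi^2 * D 1 x" for x
  define c1' where "c1' x = lm^2 * rho * D 2 x - (mu * lm * (D 4 x - 3 * xi^2 * D 2 x) + B^2 * D 4 x) + B^2 * xi^2 * D 2 x" for x
  have I1: "((\<lambda>x. c2 x * h2 x + c2' x * h1 x) has_integral c2 b * h1 b - c2 a * h1 a) {a..b}"
  proof (rule has_integral_by_parts_antideriv[OF _ h2 h1])
    show "(c2 has_real_derivative c2' x) (at x within {a..b})" if "x \<in> {a..b}" for x
      unfolding c2_def c2'_def by (auto intro!: derivative_eq_intros d[OF that] simp del: One_nat_def)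
    show "continuous_on {a..b} c2'" unfolding c2'_def by (intro continuous_intros c)
  qed (use ab in auto)
  have I2: "((\<lambda>x. c1 x * h1 x + c1' x * h x) has_integral c1 b * h b - c1 a * h a) {a..b}"
  proof (rule has_integral_by_parts_antideriv[OF _ absolutely_integrable_continuous_real[OF h1c] h])
    show "(c1 has_real_derivative c1' x) (at x within {a..b})" if "x \<in> {a..b}" for x
      unfolding c1_def c1'_def by (auto intro!: derivative_eq_intros d[OF that] simp del: One_nat_def)
    show "continuous_on {a..b} c1'" unfolding c1'_def by (intro continuous_intros c D4)
  qed (use ab in auto)
  have I: "((\<lambda>x. (c2 x * h2 x + c2' x * h1 x) + (c1 x * h1 x + c1' x * h x)) has_integral P b - P a) {a..b}"
    using has_integral_add[OF I1 I2] by (simp add: P c2_def c1_def algebra_simps)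
  show ?thesis
  \<comment> \<open>The equation holds only in the open interval, hence the two exceptional
    points.\<close>
  proof (rule has_integral_spike_finite[OF _ _ I, of "{a,b}"])
    fix x assume "x \<in> {a..b} - {a, b}"
    then have "ode_res rho mu B xi lm (\<lambda>k. D k x)" using ode by auto
    then have "c1' x = lm^2 * rho * xi^2 * D 0 x + lm * mu * xi^2 * (xi^2 * D 0 x + D 2 x)"
      unfolding ode_res_def c1'_def by (simp add: algebra_simps power2_eq_square power4_eq_xxxx)
    then show "polar rho mu lm (D 0 x) (D 1 x) (D 2 x) (h x) (h1 x) (h2 x)
      = (c2 x * h2 x + c2' x * h1 x) + (c1 x * h1 x + c1' x * h x)"
      unfolding polar_def c2_def c2'_def c1_def by (simp add: algebra_simps power2_eq_square)
  qed auto
qed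

text \<open>Continuity of value and slope at 0, together with the four boundary conditions, is what
  \<open>H02\<close> asks of a piecewise smooth function; so a solution is an admissible test
  function for itself and for other growth rates.\<close>

lemma H02_glue:
  assumes "transmission lm k Dm Dp"
  shows "H02 (glue Dm Dp 0) (glue Dm Dp 1) (glue Dm Dp 2)"
proof -
  note T = assms[unfolded transmission_def]
  have m: "(Dm j has_real_derivative Dm (Suc j) x) (at x within {-1..0})" if "j < 4" "x \<in> {-1..0}" for j x
    using T that by blast
  have p: "(Dp j has_real_derivative Dp (Suc j) x) (at x within {0..1})" if "j < 4" "x \<in> {0..1}" for j x
    using T that by blast
  have cm: "continuous_on {-1..0} (Dm j)" and cp: "continuous_on {0..1} (Dp j)" if "j < 4" for j
    using m[OF that] p[OF that] by (meson DERIV_continuous_on)+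
  have "L2_antideriv (glue Dm Dp j) (glue Dm Dp (Suc j))" if "j < 2" for j
  proof (rule L2_antideriv_piecewise)
    have j: "j < 4" "Suc j < 4" using that by auto
    show "(Dm j has_real_derivative Dm (Suc j) x) (at x within {-1..0})" if "x \<in> {-1..0}" for x
      using m[OF j(1) that] .
    show "(Dp j has_real_derivative Dp (Suc j) x) (at x within {0..1})" if "x \<in> {0..1}" for x
      using p[OF j(1) that] .
    show "continuous_on {-1..0} (Dm (Suc j))" "continuous_on {0..1} (Dp (Suc j))"
      using cm[OF j(2)] cp[OF j(2)] .
    show eq: "Dm j 0 = Dp j 0" and "Dm j (-1) = 0" using T less_2_cases[OF that] by auto
    show "glue Dm Dp j x = Dm j x" if "x \<in> {-1..0}" for x using that by (simp add: glue_def)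
    show "glue Dm Dp j x = Dp j x" if "x \<in> {0..1}" for x using that eq by (auto simp: glue_def)
    show "glue Dm Dp (Suc j) x = Dm (Suc j) x" if "x \<in> {-1..<0}" for x using that by (simp add: glue_def)
    show "glue Dm Dp (Suc j) x = Dp (Suc j) x" if "x \<in> {0<..1}" for x using that by (simp add: glue_def)
  qed
  from this[of 0] this[of 1] show ?thesis
    using T unfolding H02_def H01_def by (auto simp: glue_def numeral_2_eq_2)
qed

lemma energy_density_integrable:
  assumes h: "H02 h h1 h2" and ab: "-1 \<le> a" "b \<le> 1"
  shows "(\<lambda>x. energy_density rho mu lm (h x) (h1 x) (h2 x)) integrable_on {a..b}"
proof -
  note H = H02D[OF h]
  \<comment> \<open>The cross term of the viscous square is the only one that is neither continuous
    nor a square of an L2 function.\<close>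
  have hh2: "(\<lambda>x. h x * h2 x) integrable_on {-1..1}"
    using absolutely_integrable_continuous_mult[OF H(7) L2_antiderivD(1)[OF H(2)]]
    by (auto simp: absolutely_integrable_on_def)
  have c: "(\<lambda>x. (h x)^2) integrable_on {-1..1}" "(\<lambda>x. (h1 x)^2) integrable_on {-1..1}"
    by (intro integrable_continuous_real continuous_intros H)+
  have e: "energy_density rho mu lm (h x) (h1 x) (h2 x) =
     (lm^2 * rho * xi^2 + lm * mu * xi^4) * (h x)^2 + (lm^2 * rho + lm * mu * 4 * xi^2 + B^2 * xi^2) * (h1 x)^2
     + (lm * mu + B^2) * (h2 x)^2 + (2 * lm * mu * xi^2) * (h x * h2 x)" for x
    unfolding energy_density_def by (simp add: algebra_simps power2_eq_square power4_eq_xxxx)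
  have "(\<lambda>x. energy_density rho mu lm (h x) (h1 x) (h2 x)) integrable_on {-1..1}"
    unfolding e by (intro integrable_add integrable_on_mult_right c hh2 L2_antiderivD(3)[OF H(2)])
  then show ?thesis by (rule integrable_on_subinterval) (use ab in auto)
qed

text \<open>The boundary terms at -1 and 1 vanish with h and h'. At 0 the coefficient of h' has no
  jump, and in the coefficient of h the magnetic term cancels by continuity of the slope while the
  remaining jump is \<open>k\<close>.\<close>

lemma weak_form:
  assumes T: "transmission lm k Dm Dp" and h: "H02 h h1 h2"
  obtains Im Ip where
    "((\<lambda>x. polar rm mm lm (Dm 0 x) (Dm 1 x) (Dm 2 x) (h x) (h1 x) (h2 x)) has_integral Im) {-1..0}"
    "((\<lambda>x. polar rp mp lm (Dp 0 x) (Dp 1 x) (Dp 2 x) (h x) (h1 x) (h2 x)) has_integral Ip) {0..1}"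
    "Im + Ip = k * h 0"
proof -
  note H = H02D[OF h] and TT = T[unfolded transmission_def]
  note h2 = L2_antiderivD(1)[OF H(2)]
  define Pm where "Pm x = (mm * lm * (xi^2 * Dm 0 x + Dm 2 x) + B^2 * Dm 2 x) * h1 x
      + (lm^2 * rm * Dm 1 x - (mm * lm * (Dm 3 x - 3 * xi^2 * Dm 1 x) + B^2 * Dm 3 x) + B^2 * xi^2 * Dm 1 x) * h x" for x
  define Pp where "Pp x = (mp * lm * (xi^2 * Dp 0 x + Dp 2 x) + B^2 * Dp 2 x) * h1 x
      + (lm^2 * rp * Dp 1 x - (mp * lm * (Dp 3 x - 3 * xi^2 * Dp 1 x) + B^2 * Dp 3 x) + B^2 * xi^2 * Dp 1 x) * h x" for x
  have m: "((\<lambda>x. polar rm mm lm (Dm 0 x) (Dm 1 x) (Dm 2 x) (h x) (h1 x) (h2 x)) has_integral Pm 0 - Pm (-1)) {-1..0}"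
  proof (rule polar_half[OF _ _ _ _ _ _ _ _ Pm_def])
    show "h2 absolutely_integrable_on {-1..0}"
      by (rule absolutely_integrable_on_subinterval[OF h2]) auto
    show "continuous_on {-1..0} h1" by (rule continuous_on_subset[OF H(8)]) auto
    show "(Dm j has_real_derivative Dm (Suc j) x) (at x within {-1..0})" if "j < 4" "x \<in> {-1..0}" for j x
      using TT that by blast
    show "continuous_on {-1..0} (Dm 4)" using TT by blast
    show "ode_res rm mm B xi lm (\<lambda>k. Dm k x)" if "x \<in> {-1<..<0}" for x using TT that by blast
    show "h1 y = h1 x + integral {x..y} h2" if "-1 \<le> x" "x \<le> y" "y \<le> 0" for x y
      using L2_antiderivD(4)[OF H(2), of x y] that by simp
    show "h y = h x + integral {x..y} h1" if "-1 \<le> x" "x \<le> y" "y \<le> 0" for x y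
      using L2_antiderivD(4)[OF H(1), of x y] that by simp
  qed simp
  have p: "((\<lambda>x. polar rp mp lm (Dp 0 x) (Dp 1 x) (Dp 2 x) (h x) (h1 x) (h2 x)) has_integral Pp 1 - Pp 0) {0..1}"
  proof (rule polar_half[OF _ _ _ _ _ _ _ _ Pp_def])
    show "h2 absolutely_integrable_on {0..1}"
      by (rule absolutely_integrable_on_subinterval[OF h2]) auto
    show "continuous_on {0..1} h1" by (rule continuous_on_subset[OF H(8)]) auto
    show "(Dp j has_real_derivative Dp (Suc j) x) (at x within {0..1})" if "j < 4" "x \<in> {0..1}" for j x
      using TT that by blast
    show "continuous_on {0..1} (Dp 4)" using TT by blast
    show "ode_res rp mp B xi lm (\<lambda>k. Dp k x)" if "x \<in> {0<..<1}" for x using TT that by blast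
    show "h1 y = h1 x + integral {x..y} h2" if "0 \<le> x" "x \<le> y" "y \<le> 1" for x y
      using L2_antiderivD(4)[OF H(2), of x y] that by simp
    show "h y = h x + integral {x..y} h1" if "0 \<le> x" "x \<le> y" "y \<le> 1" for x y
      using L2_antiderivD(4)[OF H(1), of x y] that by simp
  qed simp
  have "Dp 1 0 = Dm 1 0" using TT by simp
  have "Pm 0 - Pm (-1) + (Pp 1 - Pp 0) = k * h 0"
  proof -
    define X where "X = mm * lm * (xi^2 * Dm 0 0 + Dm 2 0) + B^2 * Dm 2 0"
    have X: "mp * lm * (xi^2 * Dp 0 0 + Dp 2 0) + B^2 * Dp 2 0 = X" using TT unfolding X_def by linarith
    define Y where "Y = mm * lm * (Dm 3 0 - 3 * xi^2 * Dm 1 0) + B^2 * Dm 3 0"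
    have Y: "mp * lm * (Dp 3 0 - 3 * xi^2 * Dp 1 0) + B^2 * Dp 3 0
      = k + (lm^2 * rp * Dp 1 0 - lm^2 * rm * Dm 1 0) + Y" using TT unfolding Y_def by linarith
    show ?thesis unfolding Pm_def Pp_def X Y H(3-6) X_def[symmetric] Y_def[symmetric]
      unfolding \<open>Dp 1 0 = Dm 1 0\<close>
      by (simp add: algebra_simps)
  qed
  from that[OF m p this] show ?thesis .
qed

lemma has_integral_energy_halves:
  assumes h: "H02 h h1 h2"
  shows "((\<lambda>x. energy_density rm mm lm (h x) (h1 x) (h2 x)) has_integral
      integral {-1..0} (\<lambda>x. energy_density rm mm lm (h x) (h1 x) (h2 x))) {-1..0}"
    "((\<lambda>x. energy_density rp mp lm (h x) (h1 x) (h2 x)) has_integral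
      integral {0..1} (\<lambda>x. energy_density rp mp lm (h x) (h1 x) (h2 x))) {0..1}"
  using energy_density_integrable[OF h] by auto

lemma energy_transmission:
  assumes T: "transmission lm k Dm Dp"
  shows "energy lm (glue Dm Dp 0) (glue Dm Dp 1) (glue Dm Dp 2) = k * Dm 0 0"
proof -
  note h = H02_glue[OF T]
  obtain Im Ip where I:
    "((\<lambda>x. polar rm mm lm (Dm 0 x) (Dm 1 x) (Dm 2 x) (glue Dm Dp 0 x) (glue Dm Dp 1 x) (glue Dm Dp 2 x)) has_integral Im) {-1..0}"
    "((\<lambda>x. polar rp mp lm (Dp 0 x) (Dp 1 x) (Dp 2 x) (glue Dm Dp 0 x) (glue Dm Dp 1 x) (glue Dm Dp 2 x)) has_integral Ip) {0..1}"
    "Im + Ip = k * glue Dm Dp 0 0"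
    using weak_form[OF T h] by blast
  have e: "polar rho mu lm u0 u1 u2 u0 u1 u2 = energy_density rho mu lm u0 u1 u2" for rho mu u0 u1 u2
    unfolding polar_def energy_density_def by (simp add: power2_eq_square mult.assoc)
  have 1: "((\<lambda>x. energy_density rm mm lm (glue Dm Dp 0 x) (glue Dm Dp 1 x) (glue Dm Dp 2 x)) has_integral Im) {-1..0}"
    by (rule has_integral_spike_finite[OF _ _ I(1), of "{}"]) (auto simp: glue_def e)
  have 2: "((\<lambda>x. energy_density rp mp lm (glue Dm Dp 0 x) (glue Dm Dp 1 x) (glue Dm Dp 2 x)) has_integral Ip) {0..1}"
    by (rule has_integral_spike_finite[OF _ _ I(2), of "{0}"]) (auto simp: glue_def e)
  show ?thesis using I(3) integral_unique[OF 1] integral_unique[OF 2] unfolding energy_def by (simp add: glue_def)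
qed

text \<open>This is the energy of h - t psi, expanded by the weak form and the energy identity. The
  case t = 0 gives nonnegativity of the energy itself.\<close>

lemma energy_shift_nonneg:
  assumes T: "transmission lm k Dm Dp" and h: "H02 h h1 h2" and lm: "lm \<ge> 0"
  shows "0 \<le> energy lm h h1 h2 - 2 * t * (k * h 0) + t^2 * (k * Dm 0 0)"
proof -
  let ?g = "glue Dm Dp"
  obtain Im Ip where I:
    "((\<lambda>x. polar rm mm lm (Dm 0 x) (Dm 1 x) (Dm 2 x) (h x) (h1 x) (h2 x)) has_integral Im) {-1..0}"
    "((\<lambda>x. polar rp mp lm (Dp 0 x) (Dp 1 x) (Dp 2 x) (h x) (h1 x) (h2 x)) has_integral Ip) {0..1}"
    "Im + Ip = k * h 0"
    using weak_form[OF T h] by blast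
  have Im': "((\<lambda>x. polar rm mm lm (?g 0 x) (?g 1 x) (?g 2 x) (h x) (h1 x) (h2 x)) has_integral Im) {-1..0}"
    by (rule has_integral_spike_finite[OF _ _ I(1), of "{}"]) (auto simp: glue_def)
  have Ip': "((\<lambda>x. polar rp mp lm (?g 0 x) (?g 1 x) (?g 2 x) (h x) (h1 x) (h2 x)) has_integral Ip) {0..1}"
    by (rule has_integral_spike_finite[OF _ _ I(2), of "{0}"]) (auto simp: glue_def)
  have ident: "energy_density rho mu lm (h x - t * ?g 0 x) (h1 x - t * ?g 1 x) (h2 x - t * ?g 2 x)
    = energy_density rho mu lm (h x) (h1 x) (h2 x) - 2 * t * polar rho mu lm (?g 0 x) (?g 1 x) (?g 2 x) (h x) (h1 x) (h2 x)
      + t^2 * energy_density rho mu lm (?g 0 x) (?g 1 x) (?g 2 x)" for rho mu x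
    unfolding polar_def energy_density_def by (simp add: power2_eq_square algebra_simps)
  note hI = has_integral_energy_halves[OF h, of lm] and gI = has_integral_energy_halves[OF H02_glue[OF T], of lm]
  note m = has_integral_nonneg[OF has_integral_add[OF has_integral_diff[OF hI(1)
      has_integral_mult_right[OF Im', of "2 * t"]] has_integral_mult_right[OF gI(1), of "t^2"]]]
  note p = has_integral_nonneg[OF has_integral_add[OF has_integral_diff[OF hI(2)
      has_integral_mult_right[OF Ip', of "2 * t"]] has_integral_mult_right[OF gI(2), of "t^2"]]]
  have "0 \<le> energy lm h h1 h2 - 2 * t * (Im + Ip) + t^2 * energy lm (?g 0) (?g 1) (?g 2)"
    using add_nonneg_nonneg[OF m p] rm_pos rp_gt mp_pos mm_pos lm
    unfolding ident[symmetric] energy_def by (simp add: energy_density_nonneg distrib_left)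
  then show ?thesis unfolding I(3) energy_transmission[OF T] .
qed

lemma transmission_cauchy_schwarz:
  assumes T: "transmission lm 1 Dm Dp" and h: "H02 h h1 h2" and lm: "lm \<ge> 0"
  shows "(h 0)^2 \<le> Dm 0 0 * energy lm h h1 h2" and "Dm 0 0 \<ge> 0"
proof -
  define v N where "v = Dm 0 0" "N = energy lm h h1 h2"
  have *: "0 \<le> N - 2 * t * h 0 + t^2 * v" for t
    using energy_shift_nonneg[OF T h lm, of t] by (simp add: v_N_def)
  have N: "N \<ge> 0" using *[of 0] by simp
  have "energy lm (glue Dm Dp 0) (glue Dm Dp 1) (glue Dm Dp 2) \<ge> 0"
    using energy_shift_nonneg[OF T H02_glue[OF T] lm, of 0] by simp
  then have v: "v \<ge> 0" using energy_transmission[OF T] by (simp add: v_N_def)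
  then show "Dm 0 0 \<ge> 0" by (simp add: v_N_def)
  have "(h 0)^2 \<le> v * N"
  proof (cases "v = 0")
    case True
    \<comment> \<open>If v = 0 the expression is affine in t, and this t would make it N - 2 (N + 1)
      < 0 unless \<open>h 0 = 0\<close>.\<close>
    then have "0 \<le> N - 2 * ((N + 1) / h 0) * h 0" using *[of "(N + 1) / h 0"] by simp
    then have "h 0 = 0" using N by (cases "h 0 = 0") auto
    then show ?thesis using True by simp
  next
    case False
    \<comment> \<open>The minimiser of the quadratic in t.\<close>
    have "0 \<le> N - 2 * (h 0 / v) * h 0 + (h 0 / v)^2 * v" by (rule *)
    also have "\<dots> = N - (h 0)^2 / v" using False by (simp add: power2_eq_square field_simps)
    finally show ?thesis using v False by (simp add: field_simps)
  qed
  then show "(h 0)^2 \<le> Dm 0 0 * energy lm h h1 h2" by (simp add: v_N_def)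
qed

end

section \<open>Fundamental systems\<close>

text \<open>Taylor coefficients, without the factorials, of the solution of y'''' = b y'' - c y
  with y = y' = y'' = 0 and y''' = 1 at the origin.\<close>
fun series_coeff :: "real \<Rightarrow> real \<Rightarrow> nat \<Rightarrow> real" where
  "series_coeff b c 0 = 0"
| "series_coeff b c (Suc 0) = 0"
| "series_coeff b c (Suc (Suc 0)) = 0"
| "series_coeff b c (Suc (Suc (Suc 0))) = 1"
| "series_coeff b c (Suc (Suc (Suc (Suc n)))) = b * series_coeff b c (Suc (Suc n)) - c * series_coeff b c n"

text \<open>Each step of the recursion costs a factor of at most |b| + |c|. Geometric growth
  suffices, since division by the factorials makes the series converge everywhere.\<close>

lemma series_coeff_bound: "\<bar>series_coeff b c n\<bar> \<le> (1 + \<bar>b\<bar> + \<bar>c\<bar>) ^ n"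
proof (induction b c n rule: series_coeff.induct)
  case (4 b c)
  show ?case using one_le_power[of "1 + \<bar>b\<bar> + \<bar>c\<bar>" 3] by (simp add: numeral_eq_Suc)
next
  case (5 b c n)
  define R where "R = 1 + \<bar>b\<bar> + \<bar>c\<bar>"
  have R: "R \<ge> 1" "\<bar>b\<bar> + \<bar>c\<bar> \<le> R" unfolding R_def by auto
  have "\<bar>series_coeff b c (Suc (Suc (Suc (Suc n))))\<bar>
      \<le> \<bar>b\<bar> * \<bar>series_coeff b c (Suc (Suc n))\<bar> + \<bar>c\<bar> * \<bar>series_coeff b c n\<bar>"
    by (simp flip: abs_mult)
  also have "\<dots> \<le> \<bar>b\<bar> * R ^ (n + 3) + \<bar>c\<bar> * R ^ (n + 3)"
  proof (intro add_mono mult_left_mono)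
    have "R ^ Suc (Suc n) \<le> R ^ (n + 3)" "R ^ n \<le> R ^ (n + 3)" using R by (intro power_increasing; simp)+
    with 5 show "\<bar>series_coeff b c (Suc (Suc n))\<bar> \<le> R ^ (n + 3)" "\<bar>series_coeff b c n\<bar> \<le> R ^ (n + 3)"
      unfolding R_def by linarith+
  qed auto
  also have "\<dots> = (\<bar>b\<bar> + \<bar>c\<bar>) * R ^ (n + 3)" by (simp add: algebra_simps)
  also have "\<dots> \<le> R * R ^ (n + 3)" using R by (intro mult_right_mono) auto
  also have "\<dots> = R ^ Suc (Suc (Suc (Suc n)))" by (simp add: numeral_eq_Suc)
  finally show ?case unfolding R_def .
qed auto

lemma fundamental_solution_exists:
  fixes b c :: real
  obtains e :: "nat \<Rightarrow> real \<Rightarrow> real" where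
    "\<And>k x. (e k has_real_derivative e (Suc k) x) (at x)"
    "\<And>k x. e (k + 4) x = b * e (k + 2) x - c * e k x"
    "e 0 0 = 0" "e 1 0 = 0" "e 2 0 = 0" "e 3 0 = 1"
proof -
  \<comment> \<open>Differentiating an exponential generating function shifts its coefficients, so
    \<open>s k\<close> belongs to the k-th derivative and the recursion for the coefficients becomes
    the differential equation.\<close>
  define s where "s k n = series_coeff b c (n + k) / fact n" for k n
  define e where "e k x = (\<Sum>n. s k n * x ^ n)" for k x
  define R where "R = 1 + \<bar>b\<bar> + \<bar>c\<bar>"
  have sm: "summable (\<lambda>n. s k n * y ^ n)" for k y
  proof (rule summable_comparison_test')
    show "summable (\<lambda>n. R ^ k * (inverse (fact n) * (R * \<bar>y\<bar>) ^ n))"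
      using summable_exp[of "R * \<bar>y\<bar>"] by (intro summable_mult) simp
    show "norm (s k n * y ^ n) \<le> R ^ k * (inverse (fact n) * (R * \<bar>y\<bar>) ^ n)" for n
    proof -
      have "norm (s k n * y ^ n) = \<bar>series_coeff b c (n + k)\<bar> * (inverse (fact n) * \<bar>y\<bar> ^ n)"
        by (simp add: s_def abs_mult power_abs divide_inverse)
      also have "\<dots> \<le> R ^ (n + k) * (inverse (fact n) * \<bar>y\<bar> ^ n)"
        using series_coeff_bound[of b c "n + k"] by (intro mult_right_mono) (auto simp: R_def)
      also have "\<dots> = R ^ k * (inverse (fact n) * (R * \<bar>y\<bar>) ^ n)"
        by (simp add: power_add power_mult_distrib)
      finally show ?thesis .
    qed
  qed
  have diffs: "diffs (s k) = s (Suc k)" for k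
    by (rule ext) (simp add: diffs_def s_def del: of_nat_Suc)
  show ?thesis
  proof (rule that[of e])
    show "(e k has_real_derivative e (Suc k) x) (at x)" for k x
      using termdiffs_strong_converges_everywhere[of "s k" x, OF sm] unfolding diffs e_def .
    show "e (k + 4) x = b * e (k + 2) x - c * e k x" for k x
    proof -
      have r: "s (k + 4) n * x ^ n = b * (s (k + 2) n * x ^ n) - c * (s k n * x ^ n)" for n
      proof -
        have "series_coeff b c (n + (k + 4)) = b * series_coeff b c (n + (k + 2)) - c * series_coeff b c (n + k)"
          by (simp add: numeral_eq_Suc)
        then show ?thesis by (simp add: s_def divide_simps) (simp add: algebra_simps)
      qed
      show ?thesis unfolding e_def r
        by (simp add: suminf_diff[symmetric] suminf_mult[symmetric] summable_mult sm)
    qed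
    have "e k 0 = series_coeff b c k" for k using powser_zero[of "s k"] by (simp add: e_def s_def)
    then show "e 0 0 = 0" "e 1 0 = 0" "e 2 0 = 0" "e 3 0 = 1" by (simp_all add: numeral_eq_Suc)
  qed
qed

text \<open>Linearity in the Cauchy data \<open>u\<close> turns jump and boundary conditions into a
  linear map of \<open>u\<close>; the last property recovers \<open>u\<close> from the
  solution.\<close>

lemma cauchy_solution_exists:
  fixes b c :: real
  obtains S :: "real \<times> real \<times> real \<times> real \<Rightarrow> nat \<Rightarrow> real \<Rightarrow> real" where
    "\<And>u v k x. S (u + v) k x = S u k x + S v k x"
    "\<And>r u k x. S (r *\<^sub>R u) k x = r * S u k x"
    "\<And>u k x. (S u k has_real_derivative S u (Suc k) x) (at x)"
    "\<And>u k x. S u (k + 4) x = b * S u (k + 2) x - c * S u k x"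
    "\<And>u. u = (S u 0 0, S u 1 0, S u 2 0, S u 3 0)"
proof -
  obtain e where e: "\<And>k x. (e k has_real_derivative e (Suc k) x) (at x)"
    "\<And>k x. e (k + 4) x = b * e (k + 2) x - c * e k x"
    "e 0 0 = 0" "e 1 0 = 0" "e 2 0 = 0" "e 3 0 = 1"
    using fundamental_solution_exists by blast
  \<comment> \<open>e''' - b e', e'' - b e, e' and e have the unit vectors as Cauchy data at 0\<close>
  define S where "S u k x = (case u of (c0, c1, c2, c3) \<Rightarrow>
      c0 * (e (k + 3) x - b * e (k + 1) x) + c1 * (e (k + 2) x - b * e k x) + c2 * e (k + 1) x + c3 * e k x)" for u k x
  show ?thesis
  proof (rule that[of S])
    show "S (u + v) k x = S u k x + S v k x" for u v k x
      by (cases u; cases v) (simp add: S_def algebra_simps)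
    show "S (r *\<^sub>R u) k x = r * S u k x" for r u k x
      by (cases u) (simp add: S_def algebra_simps)
    show "(S u k has_real_derivative S u (Suc k) x) (at x)" for u k x
      unfolding S_def by (cases u) (auto intro!: derivative_eq_intros e simp: algebra_simps)
    show "S u (k + 4) x = b * S u (k + 2) x - c * S u k x" for u k x
    proof -
      have rec: "e (Suc (Suc (Suc (Suc j)))) x = b * e (Suc (Suc j)) x - c * e j x" for j
        using e(2)[of j x] by (simp add: numeral_eq_Suc)
      show ?thesis by (cases u) (simp add: S_def numeral_eq_Suc rec algebra_simps)
    qed
    \<comment> \<open>The value \<open>e 5 0 = b\<close> is what the corrections - b e' and - b e
      cancel.\<close>
    have e4: "e 4 0 = 0" "e 5 0 = b" "e 6 0 = 0"
      using e(2)[of 0 0] e(2)[of 1 0] e(2)[of 2 0] e(3-6) by (simp_all add: numeral_eq_Suc)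
    show "u = (S u 0 0, S u 1 0, S u 2 0, S u 3 0)" for u
      using e(3-6) e4 by (cases u) (simp add: S_def numeral_eq_Suc)
  qed
qed

text \<open>At an endpoint the one-sided derivative already determines the two-sided one. This is
  needed at 0, where the Cauchy data are read off.\<close>

lemma iterated_derivative_zero:
  fixes D :: "nat \<Rightarrow> real \<Rightarrow> real"
  assumes "a < b" and D: "\<And>k x. (D k has_real_derivative D (Suc k) x) (at x)"
    and "\<And>x. x \<in> {a..b} \<Longrightarrow> D 0 x = 0" "x \<in> {a..b}"
  shows "D k x = 0"
  using assms(4)
proof (induction k arbitrary: x)
  case (Suc k)
  have "(D k has_vector_derivative D (Suc k) x) (at x within {a..b})"
    using D[of k x] by (simp add: has_real_derivative_iff_has_vector_derivative has_vector_derivative_at_within)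
  moreover have "(D k has_vector_derivative 0) (at x within {a..b})"
    by (rule has_vector_derivative_transform[where f = "\<lambda>_. 0"]) (use Suc in auto)
  ultimately show ?case
    using vector_derivative_unique_within_closed_interval[of a b x "D k"] \<open>a < b\<close> Suc.prems by auto
qed (use assms in auto)

section \<open>Energy estimates\<close>

text \<open>Cauchy-Schwarz on each half, of length 1. The tent 1 - |x| attains equality, so that
  |B|_c^2 = g [rho] / 2.\<close>

lemma H01_bound_at_0:
  assumes "H01 h h1"
  shows "2 * (h 0)^2 \<le> integral {-1..1} (\<lambda>x. (h1 x)^2)"
proof -
  have L: "L2_antideriv h h1" and e: "h 1 = 0" using assms unfolding H01_def by auto
  note D = L2_antiderivD[OF L]
  have i: "h1 integrable_on {-1..0}" "h1 integrable_on {0..1}"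
    "(\<lambda>x. (h1 x)^2) integrable_on {-1..0}" "(\<lambda>x. (h1 x)^2) integrable_on {0..1}"
    using D(2,3) by (auto intro: integrable_on_subinterval)
  have "h 0 = integral {-1..0} h1" using D(4)[of "-1" 0] D(6) by simp
  then have 1: "(h 0)^2 \<le> integral {-1..0} (\<lambda>x. (h1 x)^2)"
    using square_integral_le[OF _ i(1,3)] by simp
  have "integral {0..1} h1 = - h 0" using D(4)[of 0 1] e by simp
  then have 2: "(h 0)^2 \<le> integral {0..1} (\<lambda>x. (h1 x)^2)"
    using square_integral_le[OF _ i(2,4)] by simp
  show ?thesis
    using 1 2 Henstock_Kurzweil_Integration.integral_combine[of "-1" 0 1, OF _ _ D(3)] by simp
qed

lemma H01_zero:
  assumes "H01 h h1" "integral {-1..1} (\<lambda>x. (h1 x)^2) \<le> 0" "x \<in> {-1..1}"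
  shows "h x = 0"
proof -
  have L: "L2_antideriv h h1" using assms unfolding H01_def by auto
  note D = L2_antiderivD[OF L]
  have i: "h1 integrable_on {-1..x}" "(\<lambda>x. (h1 x)^2) integrable_on {-1..x}"
    using D(2,3) assms(3) by (auto intro: integrable_on_subinterval)
  have "h x = integral {-1..x} h1" using D(4)[of "-1" x] D(6) assms(3) by simp
  then have "(h x)^2 \<le> (x + 1) * integral {-1..x} (\<lambda>x. (h1 x)^2)"
    using square_integral_le[OF _ i] assms(3) by simp
  also have "\<dots> \<le> (x + 1) * integral {-1..1} (\<lambda>x. (h1 x)^2)"
    using assms(3) D(3) i by (intro mult_left_mono integral_subset_le) auto
  also have "\<dots> \<le> 0" using assms(2,3) by (intro mult_nonneg_nonpos) auto
  finally show ?thesis by simp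
qed

context rayleigh_taylor
begin

text \<open>Transfers a pointwise comparison to the integrals; two terms are allowed because small
  \<open>lm\<close> is compared with the energies at 1 and at 0 simultaneously.\<close>

lemma energy_le:
  assumes h: "H02 h h1 h2"
    and le: "\<And>rho mu u0 u1 u2. rho > 0 \<Longrightarrow> mu > 0 \<Longrightarrow> energy_density rho mu lm u0 u1 u2
      \<le> a * energy_density rho mu l1 u0 u1 u2 + b * energy_density rho mu l2 u0 u1 u2"
  shows "energy lm h h1 h2 \<le> a * energy l1 h h1 h2 + b * energy l2 h h1 h2"
proof -
  note I = has_integral_energy_halves[OF h]
  note m = has_integral_le[OF I(1)[of lm] has_integral_add[OF has_integral_mult_right[OF I(1)[of l1], of a]
      has_integral_mult_right[OF I(1)[of l2], of b]]]
  note p = has_integral_le[OF I(2)[of lm] has_integral_add[OF has_integral_mult_right[OF I(2)[of l1], of a]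
      has_integral_mult_right[OF I(2)[of l2], of b]]]
  show ?thesis
    using add_mono[OF m p] le rm_pos rp_gt mp_pos mm_pos unfolding energy_def by (simp add: distrib_left)
qed

lemma energy_mono:
  assumes h: "H02 h h1 h2" and l: "0 \<le> l1" "l1 \<le> l2"
  shows "energy l1 h h1 h2 \<le> energy l2 h h1 h2"
proof -
  have "energy l1 h h1 h2 \<le> 1 * energy l2 h h1 h2 + 0 * energy l2 h h1 h2"
    by (rule energy_le[OF h]) (use l in \<open>auto simp: energy_density_def intro!: add_mono mult_mono\<close>)
  then show ?thesis by simp
qed

lemma energy_scale:
  assumes h: "H02 h h1 h2" and l: "0 < l1" "l1 \<le> l2"
  shows "energy l2 h h1 h2 \<le> (l2 / l1)^2 * energy l1 h h1 h2"
proof -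
  define q where "q = l2 / l1"
  have q: "q \<ge> 1" "l2 = q * l1" using l by (auto simp: q_def)
  have q2: "q \<le> q^2" "1 \<le> q^2" using q by (auto simp: power2_eq_square mult_le_cancel_left1 intro: order_trans)
  have "energy l2 h h1 h2 \<le> q^2 * energy l1 h h1 h2 + 0 * energy l1 h h1 h2"
  proof (rule energy_le[OF h])
    fix rho mu u0 u1 u2 :: real assume "rho > 0" "mu > 0"
    have "energy_density rho mu l2 u0 u1 u2 = q^2 * (l1^2 * rho * (xi^2 * u0^2 + u1^2))
        + q * (l1 * mu * ((xi^2 * u0 + u2)^2 + 4 * xi^2 * u1^2)) + 1 * (B^2 * (u2^2 + xi^2 * u1^2))"
      unfolding energy_density_def q(2) by (simp add: power_mult_distrib mult.assoc)
    also have "\<dots> \<le> q^2 * (l1^2 * rho * (xi^2 * u0^2 + u1^2))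
        + q^2 * (l1 * mu * ((xi^2 * u0 + u2)^2 + 4 * xi^2 * u1^2)) + q^2 * (B^2 * (u2^2 + xi^2 * u1^2))"
      using l q2 \<open>mu > 0\<close> \<open>rho > 0\<close> by (intro add_mono mult_right_mono mult_nonneg_nonneg add_nonneg_nonneg) auto
    also have "\<dots> = q^2 * energy_density rho mu l1 u0 u1 u2 + 0 * energy_density rho mu l1 u0 u1 u2"
      unfolding energy_density_def by (simp add: distrib_left)
    finally show "energy_density rho mu l2 u0 u1 u2
      \<le> q^2 * energy_density rho mu l1 u0 u1 u2 + 0 * energy_density rho mu l1 u0 u1 u2" .
  qed
  then show ?thesis by (simp add: q_def)
qed

text \<open>Lets a strict upper bound on \<open>energy 0\<close> survive for small positive
  \<open>lm\<close>; the linear rate comes from lm^2 <= lm.\<close>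

lemma energy_small:
  assumes h: "H02 h h1 h2" and l: "0 \<le> lm" "lm \<le> 1"
  shows "energy lm h h1 h2 \<le> lm * energy 1 h h1 h2 + energy 0 h h1 h2"
proof -
  have "energy lm h h1 h2 \<le> lm * energy 1 h h1 h2 + 1 * energy 0 h h1 h2"
  proof (rule energy_le[OF h])
    fix rho mu u0 u1 u2 :: real assume r: "rho > 0" "mu > 0"
    have "lm^2 \<le> lm" using l by (simp add: power2_eq_square mult_left_le)
    then have "lm^2 * (rho * (xi^2 * u0^2 + u1^2)) \<le> lm * (rho * (xi^2 * u0^2 + u1^2))"
      using r by (intro mult_right_mono) auto
    moreover have "0 \<le> lm * (B^2 * (u2^2 + xi^2 * u1^2))" using l by auto
    ultimately show "energy_density rho mu lm u0 u1 u2
      \<le> lm * energy_density rho mu 1 u0 u1 u2 + 1 * energy_density rho mu 0 u0 u1 u2"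
      unfolding energy_density_def by (simp add: distrib_left mult.assoc)
  qed
  then show ?thesis by simp
qed

text \<open>The viscous part is dropped, and of the inertial part only the slope term is kept, with
  the smaller density \<open>rm\<close>. That term makes solutions small for large
  \<open>lm\<close>. At \<open>lm\<close> = 0 only the magnetic part remains.\<close>

lemma energy_lower:
  assumes h: "H02 h h1 h2" and l: "0 \<le> lm"
  shows "B^2 * integral {-1..1} (\<lambda>x. (h2 x)^2) + (B^2 * xi^2 + lm^2 * rm) * integral {-1..1} (\<lambda>x. (h1 x)^2)
    \<le> energy lm h h1 h2"
    and "energy 0 h h1 h2 = B^2 * integral {-1..1} (\<lambda>x. (h2 x)^2) + B^2 * xi^2 * integral {-1..1} (\<lambda>x. (h1 x)^2)"
proof -
  note D = L2_antiderivD(3)[OF H02D(1)[OF h]] L2_antiderivD(3)[OF H02D(2)[OF h]]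
  define f where "f k x = B^2 * (h2 x)^2 + k * (h1 x)^2" for k x
  have fi: "f k integrable_on {-1..1}" for k unfolding f_def by (intro integrable_add integrable_on_mult_right D)
  have fI: "integral {-1..1} (f k) = B^2 * integral {-1..1} (\<lambda>x. (h2 x)^2) + k * integral {-1..1} (\<lambda>x. (h1 x)^2)" for k
    unfolding f_def using D by (subst integral_add) (auto intro!: integrable_on_mult_right)
  have fs: "integral {-1..1} (f k) = integral {-1..0} (f k) + integral {0..1} (f k)" for k
    using Henstock_Kurzweil_Integration.integral_combine[of "-1" 0 1, OF _ _ fi] by simp
  have fh: "f k integrable_on {-1..0}" "f k integrable_on {0..1}" for k
    by (rule integrable_on_subinterval[OF fi]; simp)+
  have le: "f (B^2 * xi^2 + lm^2 * rm) x \<le> energy_density rho mu lm (h x) (h1 x) (h2 x)"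
    if "rho \<ge> rm" "mu > 0" for rho mu x
  proof -
    have "lm^2 * rm * (h1 x)^2 \<le> lm^2 * rho * (xi^2 * (h x)^2 + (h1 x)^2)"
      using that rm_pos by (intro mult_mono) auto
    moreover have "0 \<le> lm * mu * ((xi^2 * h x + h2 x)^2 + 4 * xi^2 * (h1 x)^2)" using that l by auto
    ultimately show ?thesis unfolding f_def energy_density_def by (simp add: algebra_simps)
  qed
  have "integral {-1..1} (f (B^2 * xi^2 + lm^2 * rm)) \<le> energy lm h h1 h2"
    unfolding fs energy_def using rp_gt mp_pos mm_pos
    by (intro add_mono integral_le fh energy_density_integrable[OF h] le) auto
  then show "B^2 * integral {-1..1} (\<lambda>x. (h2 x)^2) + (B^2 * xi^2 + lm^2 * rm) * integral {-1..1} (\<lambda>x. (h1 x)^2)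
    \<le> energy lm h h1 h2" unfolding fI .
  have "energy_density rho mu 0 (h x) (h1 x) (h2 x) = f (B^2 * xi^2) x" for rho mu x
    unfolding f_def energy_density_def by (simp add: algebra_simps)
  then have "energy 0 h h1 h2 = integral {-1..1} (f (B^2 * xi^2))" unfolding energy_def fs by simp
  then show "energy 0 h h1 h2 = B^2 * integral {-1..1} (\<lambda>x. (h2 x)^2) + B^2 * xi^2 * integral {-1..1} (\<lambda>x. (h1 x)^2)"
    unfolding fI .
qed

text \<open>The excess over \<open>energy 0\<close> controls the slope independently of
  \<open>xi\<close>, so \<open>xi\<close> = 0 is covered.\<close>

lemma energy_zeroD:
  assumes h: "H02 h h1 h2" and l: "0 < lm" and z: "energy lm h h1 h2 \<le> energy 0 h h1 h2" and x: "x \<in> {-1..1}"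
  shows "h x = 0"
proof (rule H01_zero[OF _ _ x])
  show "H01 h h1" using h unfolding H02_def by simp
  have "lm^2 * rm * integral {-1..1} (\<lambda>x. (h1 x)^2) \<le> 0"
    using energy_lower[OF h, of lm] l z by (simp add: algebra_simps)
  then show "integral {-1..1} (\<lambda>x. (h1 x)^2) \<le> 0" using l rm_pos by (simp add: mult_le_0_iff)
qed

section \<open>The response function and the growth rate\<close>

lemma transmission_exists:
  assumes lm: "lm > 0"
  obtains Dm Dp where "transmission lm 1 Dm Dp"
    "\<And>k x. (Dm k has_real_derivative Dm (Suc k) x) (at x)"
    "\<And>k x. (Dp k has_real_derivative Dp (Suc k) x) (at x)"
proof -
  \<comment> \<open>The equation solved for the fourth derivative, whose coefficient is mu lm + B^2
    > 0.\<close>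
  define b where "b rho mu = (2 * mu * lm * xi^2 + B^2 * xi^2 + lm^2 * rho) / (mu * lm + B^2)" for rho mu
  define c where "c rho mu = (mu * lm * xi^4 + lm^2 * rho * xi^2) / (mu * lm + B^2)" for rho mu
  have ode: "ode_res rho mu B xi lm d" if "mu > 0" "d 4 = b rho mu * d 2 - c rho mu * d 0" for rho mu and d :: "nat \<Rightarrow> real"
  proof -
    define A where "A = mu * lm + B^2"
    have A: "A > 0" using that(1) lm by (simp add: A_def add_pos_nonneg)
    have bc: "A * b rho mu = 2 * mu * lm * xi^2 + B^2 * xi^2 + lm^2 * rho"
      "A * c rho mu = mu * lm * xi^4 + lm^2 * rho * xi^2" using A by (simp_all add: b_def c_def flip: A_def)
    have "A * d 4 = (A * b rho mu) * d 2 - (A * c rho mu) * d 0"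
      unfolding that(2) by (simp only: right_diff_distrib mult.assoc)
    then have "(mu * lm + B^2) * d 4 = (2 * mu * lm * xi^2 + B^2 * xi^2 + lm^2 * rho) * d 2
      - (mu * lm * xi^4 + lm^2 * rho * xi^2) * d 0" unfolding bc unfolding A_def .
    then show ?thesis unfolding ode_res_def by (simp add: algebra_simps)
  qed
  obtain Sm where Sm: "\<And>u v k x. Sm (u + v) k x = Sm u k x + Sm v k x"
    "\<And>r u k x. Sm (r *\<^sub>R u) k x = r * Sm u k x"
    "\<And>u k x. (Sm u k has_real_derivative Sm u (Suc k) x) (at x)"
    "\<And>u k x. Sm u (k + 4) x = b rm mm * Sm u (k + 2) x - c rm mm * Sm u k x"
    "\<And>u. u = (Sm u 0 0, Sm u 1 0, Sm u 2 0, Sm u 3 0)"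
    using cauchy_solution_exists by blast
  obtain Sp where Sp: "\<And>u v k x. Sp (u + v) k x = Sp u k x + Sp v k x"
    "\<And>r u k x. Sp (r *\<^sub>R u) k x = r * Sp u k x"
    "\<And>u k x. (Sp u k has_real_derivative Sp u (Suc k) x) (at x)"
    "\<And>u k x. Sp u (k + 4) x = b rp mp * Sp u (k + 2) x - c rp mp * Sp u k x"
    "\<And>u. u = (Sp u 0 0, Sp u 1 0, Sp u 2 0, Sp u 3 0)"
    using cauchy_solution_exists by blast
  \<comment> \<open>Four jumps and four boundary values, grouped like the pair of Cauchy quadruples:
    domain and target both have dimension 8, so injectivity will give surjectivity.\<close>
  define J where "J Dm Dp = (((Dp 0 0 - Dm 0 0, Dp 1 0 - Dm 1 0,
     (mp * lm * (xi^2 * Dp 0 0 + Dp 2 0) + B^2 * Dp 2 0)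
       - (mm * lm * (xi^2 * Dm 0 0 + Dm 2 0) + B^2 * Dm 2 0),
     (mp * lm * (Dp 3 0 - 3 * xi^2 * Dp 1 0) + B^2 * Dp 3 0)
       - (mm * lm * (Dm 3 0 - 3 * xi^2 * Dm 1 0) + B^2 * Dm 3 0)
       - (lm^2 * rp * Dp 1 0 - lm^2 * rm * Dm 1 0)),
     (Dm 0 (-1), Dp 0 1, Dm 1 (-1), Dp 1 1)))" for Dm Dp :: "nat \<Rightarrow> real \<Rightarrow> real"
  define L where "L w = J (Sm (fst w)) (Sp (snd w))" for w
  have T: "transmission lm k (Sm (fst w)) (Sp (snd w))" if "L w = ((0, 0, 0, k), (0, 0, 0, 0))" for w k
  proof -
    have "ode_res rm mm B xi lm (\<lambda>k. Sm (fst w) k x)" "ode_res rp mp B xi lm (\<lambda>k. Sp (snd w) k x)" for x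
      by (rule ode[OF mm_pos] ode[OF mp_pos], fact Sm(4)[of _ 0, unfolded add_0] Sp(4)[of _ 0, unfolded add_0])+
    moreover have "continuous_on X (Sm (fst w) 4)" "continuous_on X (Sp (snd w) 4)" for X
      using Sm(3) Sp(3) by (meson DERIV_continuous_on DERIV_subset subset_UNIV)+
    moreover have "(Sm (fst w) j has_real_derivative Sm (fst w) (Suc j) x) (at x within X)"
      "(Sp (snd w) j has_real_derivative Sp (snd w) (Suc j) x) (at x within X)" for j x X
      using Sm(3) Sp(3) has_field_derivative_at_within by blast+
    ultimately show ?thesis
      using that unfolding transmission_def L_def J_def by auto
  qed
  have "linear L"
  proof (rule linearI)
    show "L (u + v) = L u + L v" for u v
      unfolding L_def J_def by (simp add: Sm(1) Sp(1) algebra_simps)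
    show "L (r *\<^sub>R u) = r *\<^sub>R L u" for r u
      unfolding L_def J_def by (simp add: Sm(2) Sp(2) algebra_simps)
  qed
  moreover have "inj L"
    unfolding linear_injective_0[OF \<open>linear L\<close>]
  proof safe
    fix w assume "L w = 0"
    then have T0: "transmission lm 0 (Sm (fst w)) (Sp (snd w))" by (intro T) (simp add: zero_prod_def)
    let ?g = "glue (Sm (fst w)) (Sp (snd w))"
    have z: "?g 0 x = 0" if "x \<in> {-1..1}" for x
    proof (rule energy_zeroD[OF H02_glue[OF T0] lm _ that])
      \<comment> \<open>With k = 0 the solution has energy 0, while its \<open>energy 0\<close> is
        nonnegative.\<close>
      have "0 \<le> B^2 * integral {-1..1} (\<lambda>x. (?g 2 x)^2) + B^2 * xi^2 * integral {-1..1} (\<lambda>x. (?g 1 x)^2)"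
        using L2_antiderivD(3)[OF H02D(1)[OF H02_glue[OF T0]]] L2_antiderivD(3)[OF H02D(2)[OF H02_glue[OF T0]]]
        by (intro add_nonneg_nonneg mult_nonneg_nonneg Henstock_Kurzweil_Integration.integral_nonneg) auto
      then show "energy lm (?g 0) (?g 1) (?g 2) \<le> energy 0 (?g 0) (?g 1) (?g 2)"
        using energy_transmission[OF T0] energy_lower(2)[OF H02_glue[OF T0]] by simp
    qed
    have "Sm (fst w) k 0 = 0" for k
    proof (rule iterated_derivative_zero[of "-1" 0 "Sm (fst w)"])
      fix x :: real assume "x \<in> {-1..0}"
      then show "Sm (fst w) 0 x = 0" using z[of x] by (simp add: glue_def)
    qed (use Sm(3) in auto)
    moreover have "Sp (snd w) k 0 = 0" for k
    proof (rule iterated_derivative_zero[of 0 1 "Sp (snd w)"])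
      fix x :: real assume "x \<in> {0..1}"
      then show "Sp (snd w) 0 x = 0"
        using z[of x] T0[unfolded transmission_def] z[of 0] by (cases "x = 0") (auto simp: glue_def)
    qed (use Sp(3) in auto)
    ultimately have "fst w = 0" "snd w = 0"
      using Sm(5)[of "fst w"] Sp(5)[of "snd w"] by (simp_all add: zero_prod_def)
    then show "w = 0" by (simp add: prod_eq_iff)
  qed
  ultimately have "surj L" by (rule linear_injective_imp_surjective) simp
  then obtain w where "L w = ((0, 0, 0, 1), (0, 0, 0, 0))" by (metis surjD)
  from that[OF T[OF this] Sm(3) Sp(3)] show ?thesis .
qed

text \<open>By the Cauchy-Schwarz inequality the value at 0 of the solution with k = 1 is the maximum of
  h(0)^2 / energy(h), so it inherits the monotonicity and scaling of the energy in lm.\<close>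
lemma response_compare:
  assumes l: "0 < l1" "l1 \<le> l2" and T1: "transmission l1 1 Dm1 Dp1" and T2: "transmission l2 1 Dm2 Dp2"
  shows "Dm2 0 0 \<le> Dm1 0 0" and "Dm1 0 0 \<le> (l2 / l1)^2 * Dm2 0 0"
proof -
  define v1 v2 where "v1 = Dm1 0 0" "v2 = Dm2 0 0"
  note H1 = H02_glue[OF T1] and H2 = H02_glue[OF T2]
  have nn: "v1 \<ge> 0" "v2 \<ge> 0"
    using transmission_cauchy_schwarz(2)[OF T1 H1] transmission_cauchy_schwarz(2)[OF T2 H2] l by (auto simp: v1_v2_def)
  have g: "glue Dm1 Dp1 0 0 = v1" "glue Dm2 Dp2 0 0 = v2" by (auto simp: glue_def v1_v2_def)
  have E1: "energy l1 (glue Dm1 Dp1 0) (glue Dm1 Dp1 1) (glue Dm1 Dp1 2) = v1"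
    and E2: "energy l2 (glue Dm2 Dp2 0) (glue Dm2 Dp2 1) (glue Dm2 Dp2 2) = v2"
    using energy_transmission[OF T1] energy_transmission[OF T2] by (simp_all add: v1_v2_def)
  \<comment> \<open>The solution for \<open>l2\<close> competes in the maximum for
    \<open>l1\<close>, and its energy there is at most \<open>v2\<close>; afterwards one factor
    \<open>v2\<close> is cancelled. The second estimate exchanges the roles.\<close>
  have "v2^2 \<le> v1 * energy l1 (glue Dm2 Dp2 0) (glue Dm2 Dp2 1) (glue Dm2 Dp2 2)"
    using transmission_cauchy_schwarz(1)[OF T1 H2] l g by (simp add: v1_v2_def)
  also have "\<dots> \<le> v1 * v2" using energy_mono[OF H2, of l1 l2] l nn E2 by (intro mult_left_mono) auto
  finally have "v2 * v2 \<le> v1 * v2" by (simp add: power2_eq_square)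
  then have "v2 \<le> v1" using nn by (cases "v2 = 0") auto
  then show "Dm2 0 0 \<le> Dm1 0 0" by (simp add: v1_v2_def)
  have "v1^2 \<le> v2 * energy l2 (glue Dm1 Dp1 0) (glue Dm1 Dp1 1) (glue Dm1 Dp1 2)"
    using transmission_cauchy_schwarz(1)[OF T2 H1] l g by (simp add: v1_v2_def)
  also have "\<dots> \<le> v2 * ((l2 / l1)^2 * v1)" using energy_scale[OF H1, of l1 l2] l nn E1 by (intro mult_left_mono) auto
  finally have "v1 * v1 \<le> ((l2 / l1)^2 * v2) * v1" by (simp add: power2_eq_square algebra_simps)
  then have "v1 \<le> (l2 / l1)^2 * v2" using nn by (cases "v1 = 0") auto
  then show "Dm1 0 0 \<le> (l2 / l1)^2 * Dm2 0 0" by (simp add: v1_v2_def)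
qed

lemma eigenvalue_exists:
  assumes h: "H02 h h1 h2" and G: "G > 0" and neg: "energy 0 h h1 h2 < G * (h 0)^2"
  obtains lm Dm Dp where "lm > 0" "transmission lm 1 Dm Dp" "G * Dm 0 0 = 1"
    "\<And>k x. (Dm k has_real_derivative Dm (Suc k) x) (at x)"
    "\<And>k x. (Dp k has_real_derivative Dp (Suc k) x) (at x)"
proof -
  have "\<exists>Dm Dp. transmission lm 1 Dm Dp \<and> (\<forall>k x. (Dm k has_real_derivative Dm (Suc k) x) (at x)) \<and>
    (\<forall>k x. (Dp k has_real_derivative Dp (Suc k) x) (at x))" if "lm > 0" for lm
    using transmission_exists[OF that] by metis
  then obtain Dm Dp where T: "\<And>lm. lm > 0 \<Longrightarrow> transmission lm 1 (Dm lm) (Dp lm)"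
    and d: "\<And>lm k x. lm > 0 \<Longrightarrow> (Dm lm k has_real_derivative Dm lm (Suc k) x) (at x)"
      "\<And>lm k x. lm > 0 \<Longrightarrow> (Dp lm k has_real_derivative Dp lm (Suc k) x) (at x)"
    by metis
  define v where "v lm = Dm lm 0 0" for lm
  have mono: "v l2 \<le> v l1" "v l1 \<le> (l2 / l1)^2 * v l2" if "0 < l1" "l1 \<le> l2" for l1 l2
    using response_compare[OF that T T] that unfolding v_def by auto
  have cont: "isCont v s" if s: "s > 0" for s
  proof -
    \<comment> \<open>The minimum and maximum with 1 give one pair of bounds valid on both sides of
      s; both tend to \<open>v s\<close>.\<close>
    have lo: "eventually (\<lambda>x. min 1 ((s / x)^2) * v s \<le> v x) (at s)"
      and hi: "eventually (\<lambda>x. v x \<le> max 1 ((s / x)^2) * v s) (at s)"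
    proof -
      have nn: "v s \<ge> 0" using transmission_cauchy_schwarz(2)[OF T[OF s] H02_glue[OF T[OF s]]] s by (simp add: v_def)
      have pos: "eventually (\<lambda>x. x > 0) (at s)" by (rule order_tendstoD(1)[OF tendsto_ident_at s])
      have *: "min 1 ((s / x)^2) * v s \<le> v x \<and> v x \<le> max 1 ((s / x)^2) * v s" if x: "x > 0" for x
      proof (cases "x \<le> s")
        case True
        have "1 \<le> (s / x)^2" using True x by (intro one_le_power) simp
        then show ?thesis using mono[OF x True] by simp
      next
        case False
        then have *: "(s / x)^2 \<le> 1" using s by (intro power_le_one) auto
        have "v s \<le> (x / s)^2 * v x" "v x \<le> v s" using mono[OF s, of x] False by auto
        then have "(s / x)^2 * v s \<le> (s / x)^2 * ((x / s)^2 * v x)" by (intro mult_left_mono) auto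
        also have "\<dots> = v x" using s x by (simp add: power_divide)
        finally show ?thesis using * \<open>v x \<le> v s\<close> by simp
      qed
      show "eventually (\<lambda>x. min 1 ((s / x)^2) * v s \<le> v x) (at s)"
        "eventually (\<lambda>x. v x \<le> max 1 ((s / x)^2) * v s) (at s)"
        by (rule eventually_mono[OF pos]; use * in blast)+
    qed
    have "((\<lambda>x. min 1 ((s / x)^2) * v s) \<longlongrightarrow> min 1 ((s / s)^2) * v s) (at s)"
      "((\<lambda>x. max 1 ((s / x)^2) * v s) \<longlongrightarrow> max 1 ((s / s)^2) * v s) (at s)"
      using s by (intro tendsto_intros; simp)+
    then have "(v \<longlongrightarrow> v s) (at s)" using lo hi s by (intro tendsto_sandwich[OF lo hi]) auto
    then show ?thesis unfolding isCont_def .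
  qed
  obtain l0 where l0: "l0 > 0" "G * v l0 > 1"
  proof -
    define E where "E = energy 1 h h1 h2"
    define d where "d = G * (h 0)^2 - energy 0 h h1 h2"
    have d: "d > 0" using neg by (simp add: d_def)
    have E: "E \<ge> 0" using energy_shift_nonneg[OF T[of 1] h, of 0] by (simp add: E_def)
    \<comment> \<open>Chosen so that l E < d, with E + 1 allowing E = 0; the bound 1 is what the
      small-growth estimate requires.\<close>
    define l where "l = min 1 (d / (2 * (E + 1)))"
    have l: "l > 0" "l \<le> 1" "l \<le> d / (2 * (E + 1))" using d E by (auto simp: l_def)
    have "l * E \<le> d / (2 * (E + 1)) * E" using l E by (intro mult_right_mono) auto
    also have "\<dots> < d" using d E by (simp add: divide_simps)
    finally have "l * E + energy 0 h h1 h2 < G * (h 0)^2" by (simp add: d_def)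
    then have lt: "energy l h h1 h2 < G * (h 0)^2" using energy_small[OF h, of l] l by (simp add: E_def)
    have cs: "(h 0)^2 \<le> v l * energy l h h1 h2" and nn: "v l \<ge> 0"
      using transmission_cauchy_schwarz[OF T[OF l(1)] h] l by (auto simp: v_def)
    have En: "energy l h h1 h2 \<ge> 0" using energy_shift_nonneg[OF T[OF l(1)] h, of 0] l by simp
    have h0: "(h 0)^2 > 0" using lt En G by (metis leD mult_zero_right zero_less_power2 power2_eq_square)
    then have "v l \<noteq> 0" using cs by auto
    then have "v l * energy l h h1 h2 < v l * (G * (h 0)^2)" using nn lt by (intro mult_strict_left_mono) auto
    then have "1 * (h 0)^2 < (G * v l) * (h 0)^2" using cs by (simp add: algebra_simps)
    then have "1 < G * v l" using h0 by (metis mult_less_cancel_right_pos)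
    then show ?thesis using that l by blast
  qed
  obtain l1 where l1: "l1 \<ge> l0" "G * v l1 \<le> 1"
  proof -
    \<comment> \<open>The energy bound and the bound at 0 will give 2 rm l^2 (v l)^2 <= v l, and
      this l ensures 2 rm l^2 >= 2 rm l >= G.\<close>
    define l where "l = max l0 (max 1 (G / (2 * rm)))"
    have l: "l \<ge> l0" "l \<ge> 1" "l \<ge> G / (2 * rm)" "l > 0" by (auto simp: l_def)
    let ?g = "glue (Dm l) (Dp l)"
    note H = H02_glue[OF T[OF l(4)]]
    have nn: "v l \<ge> 0" using transmission_cauchy_schwarz(2)[OF T[OF l(4)] H] l by (auto simp: v_def)
    have i: "integral {-1..1} (\<lambda>x. (?g 1 x)^2) \<ge> 2 * (v l)^2"
      using H01_bound_at_0[of "?g 0" "?g 1"] H by (auto simp: H02_def v_def glue_def)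
    have "0 \<le> B^2 * integral {-1..1} (\<lambda>x. (?g 2 x)^2)" "0 \<le> B^2 * xi^2 * integral {-1..1} (\<lambda>x. (?g 1 x)^2)"
      using L2_antiderivD(3)[OF H02D(1)[OF H]] L2_antiderivD(3)[OF H02D(2)[OF H]]
      by (intro mult_nonneg_nonneg Henstock_Kurzweil_Integration.integral_nonneg; auto)+
    then have "l^2 * rm * integral {-1..1} (\<lambda>x. (?g 1 x)^2) \<le> v l"
      using energy_lower(1)[OF H, of l] energy_transmission[OF T[OF l(4)]] l by (simp add: v_def algebra_simps)
    moreover have "l^2 * rm * (2 * (v l)^2) \<le> l^2 * rm * integral {-1..1} (\<lambda>x. (?g 1 x)^2)"
      using i rm_pos by (intro mult_left_mono) auto
    ultimately have le: "l^2 * rm * (2 * (v l)^2) \<le> v l" by simp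
    have "G \<le> l * (2 * rm)" using l(3) rm_pos by (simp add: field_simps)
    also have "\<dots> \<le> l^2 * (2 * rm)" using l rm_pos by (intro mult_right_mono) (auto simp: power2_eq_square)
    finally have "G * (v l)^2 \<le> l^2 * (2 * rm) * (v l)^2" by (intro mult_right_mono) auto
    also have "\<dots> \<le> v l" using le by (simp add: algebra_simps)
    finally have "(G * v l) * v l \<le> 1 * v l" by (simp add: power2_eq_square)
    then have "G * v l \<le> 1" using nn by (cases "v l = 0") auto
    then show ?thesis using that l by blast
  qed
  \<comment> \<open>The sign is reversed because this form of the intermediate value theorem expects
    the smaller value at the left end.\<close>
  have "\<exists>s\<ge>l0. s \<le> l1 \<and> (\<lambda>s. - (G * v s)) s = - 1"
    by (rule IVT) (use l0 l1 cont in \<open>auto intro!: continuous_intros\<close>)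
  then obtain s where "s \<ge> l0" "G * v s = 1" by auto
  then show ?thesis using that[OF _ T[of s] _ d(1)[of s] d(2)[of s]] l0 by (auto simp: v_def)
qed

end

section \<open>Critical magnetic number and critical frequency\<close>

text \<open>The tent 1 - |x| maximises the quotient defining |B|_c^2 but has a kink at 0 and nonzero slope at
  the boundary; its slope, 1 on the left half, is replaced by 1 - (2x+1)^(2n).\<close>
lemma H02_near_tent:
  fixes e :: real
  assumes e: "e > 0"
  obtains h h1 h2 where "H02 h h1 h2" "integral {-1..1} (\<lambda>x. (h1 x)^2) \<le> 2" "(h 0)^2 \<ge> 1 - e" "h 0 \<noteq> 0"
proof -
  \<comment> \<open>The value at 0 will be 1 - q with q = 1 / (2n + 1), and (1 - q)^2 >= 1 - 2 q > 1
    - e.\<close>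
  obtain n :: nat where n: "real n > 1 / e" "n > 0"
    using reals_Archimedean2[of "1 / e"] e
    by (metis divide_pos_pos less_trans of_nat_0_less_iff zero_less_one)
  \<comment> \<open>On the left half 2x + 1 runs through [-1,1], so the slope \<open>fm\<close> lies
    in [0,1] and vanishes at both ends. The + 1 in the primitive makes \<open>um\<close> vanish at
    -1; the right half is the mirror image.\<close>
  define um fm gm up fp gp where
    "um x = (1 + x) - ((2 * x + 1) ^ (2 * n + 1) + 1) / (2 * (2 * real n + 1))" and
    "fm x = 1 - (2 * x + 1) ^ (2 * n)" and
    "gm x = - (4 * real n * (2 * x + 1) ^ (2 * n - 1))" and
    "up x = (1 - x) - ((- 2 * x + 1) ^ (2 * n + 1) + 1) / (2 * (2 * real n + 1))" and
    "fp x = (- 2 * x + 1) ^ (2 * n) - 1" and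
    "gp x = - (4 * real n * (- 2 * x + 1) ^ (2 * n - 1))" for x :: real
  note defs = this
  define h where "h x = (if x \<le> 0 then um x else up x)" for x
  define h1 where "h1 x = (if x \<le> 0 then fm x else fp x)" for x
  define h2 where "h2 x = (if x \<le> 0 then gm x else gp x)" for x
  have nz: "2 * real n + 1 \<noteq> 0" using n by linarith
  have pow: "((\<lambda>x. (p * x + 1) ^ m) has_real_derivative real m * (p * (p * x + 1) ^ (m - 1))) (at x within X)"
    for p x m X
    by (auto intro!: derivative_eq_intros)
  have prim: "((\<lambda>x. ((p * x + 1) ^ (2 * n + 1) + 1) / (2 * (2 * real n + 1))) has_real_derivative
      p / 2 * (p * x + 1) ^ (2 * n)) (at x within X)" for p x X
    by (rule DERIV_cong[OF DERIV_cdivide[OF DERIV_add[OF pow DERIV_const]]]) (use nz in \<open>simp add: field_simps\<close>)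
  have d: "(um has_real_derivative fm x) (at x within X)" "(up has_real_derivative fp x) (at x within X)"
    "(fm has_real_derivative gm x) (at x within X)" "(fp has_real_derivative gp x) (at x within X)" for x X
  proof -
    show "(um has_real_derivative fm x) (at x within X)"
      unfolding defs by (rule derivative_eq_intros prim refl)+ simp
    show "(up has_real_derivative fp x) (at x within X)"
      unfolding defs by (rule derivative_eq_intros prim refl)+ simp
    show "(fm has_real_derivative gm x) (at x within X)"
      unfolding defs by (rule derivative_eq_intros pow refl)+ simp
    show "(fp has_real_derivative gp x) (at x within X)"
      unfolding defs by (rule derivative_eq_intros pow refl)+ simp
  qed
  have c: "continuous_on X fm" "continuous_on X fp" "continuous_on X gm" "continuous_on X gp" for X
    unfolding defs by (intro continuous_intros)+
  have v: "um 0 = up 0" "um (-1) = 0" "up 1 = 0" "fm 0 = fp 0" "fm (-1) = 0" "fp 1 = 0"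
    unfolding defs by simp_all
  have "L2_antideriv h h1"
    by (rule L2_antideriv_piecewise[OF d(1,2) c(1,2) v(1,2)]) (auto simp: h_def h1_def v)
  moreover have "L2_antideriv h1 h2"
    by (rule L2_antideriv_piecewise[OF d(3,4) c(3,4) v(4,5)]) (auto simp: h1_def h2_def v)
  ultimately have H: "H02 h h1 h2" unfolding H02_def H01_def by (simp add: h_def h1_def v)
  have bound: "(h1 x)^2 \<le> 1" if "x \<in> {-1..1}" for x
  proof -
    have *: "0 \<le> y ^ (2 * n)" "y ^ (2 * n) \<le> 1" if "\<bar>y\<bar> \<le> 1" for y :: real
    proof -
      have "y^2 \<le> 1" using that by (simp add: abs_square_le_1)
      then show "0 \<le> y ^ (2 * n)" "y ^ (2 * n) \<le> 1" by (simp_all add: power_mult power_le_one)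
    qed
    have "\<bar>h1 x\<bar> \<le> 1"
      using *[of "2 * x + 1"] *[of "- 2 * x + 1"] that by (auto simp: h1_def defs)
    then show ?thesis by (simp add: abs_square_le_1)
  qed
  have I: "integral {-1..1} (\<lambda>x. (h1 x)^2) \<le> integral {-1..1} (\<lambda>x::real. 1::real)"
    using bound L2_antiderivD(3)[OF \<open>L2_antideriv h h1\<close>] by (intro integral_le) auto
  have h0: "h 0 = 1 - 1 / (2 * real n + 1)" by (simp add: h_def defs field_simps)
  have lt: "1 / (2 * real n + 1) < e / 2" using n e by (simp add: field_simps)
  define q where "q = 1 / (2 * real n + 1)"
  have "1 - 2 * q \<le> (1 - q)^2" by (simp add: power2_eq_square algebra_simps)
  then have "(h 0)^2 \<ge> 1 - e" using lt h0 by (simp flip: q_def)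
  moreover have "h 0 \<noteq> 0" using n by (simp add: h0)
  ultimately show ?thesis using that[OF H] I by simp
qed

lemma H01_energy_nonneg:
  assumes "H01 h h1"
  shows "integral {-1..1} (\<lambda>x. (h1 x)^2) \<ge> 0"
  using assms L2_antiderivD(3) unfolding H01_def
  by (intro Henstock_Kurzweil_Integration.integral_nonneg) auto

text \<open>A real \<open>Sup\<close> carries information only for a nonempty set that is bounded
  above.\<close>

lemma Bcrit_set_bounds:
  fixes G :: real
  assumes G: "G > 0"
  defines "S \<equiv> {G * (psi 0)^2 / integral {-1..1} (\<lambda>x. (dpsi x)^2) | psi dpsi. H01 psi dpsi \<and> nonzero_on psi}"
  shows "S \<noteq> {}" and "\<And>s. s \<in> S \<Longrightarrow> 0 \<le> s \<and> s \<le> G / 2"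
proof -
  obtain h h1 h2 where "H02 h h1 h2" "h 0 \<noteq> 0" using H02_near_tent[of 1] by (metis zero_less_one)
  then have "H01 h h1" "nonzero_on h" unfolding H02_def nonzero_on_def by auto
  then show "S \<noteq> {}" unfolding S_def by blast
  fix s assume "s \<in> S"
  then obtain psi dpsi where s: "s = G * (psi 0)^2 / integral {-1..1} (\<lambda>x. (dpsi x)^2)" and H: "H01 psi dpsi"
    unfolding S_def by blast
  define I where "I = integral {-1..1} (\<lambda>x. (dpsi x)^2)"
  have I: "I \<ge> 0" "2 * (psi 0)^2 \<le> I" using H01_energy_nonneg[OF H] H01_bound_at_0[OF H] by (auto simp: I_def)
  have "G * (psi 0)^2 \<le> G * (I / 2)" using G I by (intro mult_left_mono) auto
  then show "0 \<le> s \<and> s \<le> G / 2"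
    \<comment> \<open>For I = 0 the quotient is 0 by the convention for division.\<close>
    using I G unfolding s I_def[symmetric] by (cases "I = 0") (auto simp: field_simps)
qed

lemma Bcrit_le:
  assumes G: "G > 0" and B: "\<bar>B\<bar> \<ge> Bcrit G" and H: "H01 psi dpsi"
  shows "G * (psi 0)^2 \<le> B^2 * integral {-1..1} (\<lambda>x. (dpsi x)^2)"
proof -
  let ?I = "integral {-1..1} (\<lambda>x. (dpsi x)^2)"
  define S where "S = {G * (psi 0)^2 / integral {-1..1} (\<lambda>x. (dpsi x)^2) | psi dpsi. H01 psi dpsi \<and> nonzero_on psi}"
  note bd = Bcrit_set_bounds[OF G, folded S_def]
  show ?thesis
  proof (cases "?I = 0")
    case True
    then show ?thesis using H01_bound_at_0[OF H] by simp
  next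
    case False
    then have I: "?I > 0" using H01_energy_nonneg[OF H] by simp
    show ?thesis
    proof (cases "nonzero_on psi")
      case True
      then have m: "G * (psi 0)^2 / ?I \<in> S" using H unfolding S_def by blast
      have "bdd_above S" using bd(2) by (intro bdd_aboveI[of _ "G / 2"]) blast
      then have le: "G * (psi 0)^2 / ?I \<le> Sup S" using m by (intro cSup_upper)
      have "Sup S \<ge> 0" using le bd(2)[OF m] by linarith
      then have "Sup S = (Bcrit G)^2" "Bcrit G \<ge> 0" unfolding Bcrit_def S_def[symmetric] by auto
      moreover have "(Bcrit G)^2 \<le> \<bar>B\<bar>^2" using B \<open>Bcrit G \<ge> 0\<close> by (intro power_mono) auto
      ultimately have "G * (psi 0)^2 / ?I \<le> B^2" using le by simp
      then show ?thesis using I by (simp add: field_simps)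
    next
      case False
      then show ?thesis using I unfolding nonzero_on_def by auto
    qed
  qed
qed

text \<open>Translating the condition into numbers leaves a gap between 2 B^2 and G, wide enough for
  replacing the tent by a function of H_0^2.\<close>

lemma less_Bcrit:
  assumes G: "G > 0" and B: "\<bar>B\<bar> < Bcrit G"
  shows "2 * B^2 < G"
proof -
  define S where "S = {G * (psi 0)^2 / integral {-1..1} (\<lambda>x. (dpsi x)^2) | psi dpsi. H01 psi dpsi \<and> nonzero_on psi}"
  note bd = Bcrit_set_bounds[OF G, folded S_def]
  have "Sup S \<le> G / 2" using bd by (intro cSup_least) auto
  moreover have "B^2 < Sup S"
  proof -
    have "\<bar>B\<bar> < sqrt (Sup S)" using B unfolding Bcrit_def S_def .
    then show ?thesis using real_sqrt_less_iff[of "B^2" "Sup S"] by simp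
  qed
  ultimately show ?thesis by simp
qed

text \<open>The infimum is meaningful only once some H_0^2 function has a positive denominator; a
  sufficiently good smoothed tent does.\<close>

lemma xi_vc_set_bounds:
  fixes G B :: real
  assumes G: "G > 0" and B: "\<bar>B\<bar> < Bcrit G"
  defines "X \<equiv> {B^2 * integral {-1..1} (\<lambda>x. (d2 x)^2) /
        (G * (psi 0)^2 - B^2 * integral {-1..1} (\<lambda>x. (d1 x)^2)) |
        psi d1 d2. H02 psi d1 d2 \<and> G * (psi 0)^2 - B^2 * integral {-1..1} (\<lambda>x. (d1 x)^2) > 0}"
  shows "X \<noteq> {}" and "\<And>s. s \<in> X \<Longrightarrow> 0 \<le> s"
proof -
  have lt: "2 * B^2 < G" by (rule less_Bcrit[OF G B])
  \<comment> \<open>Makes G (1 - e) the midpoint of 2 B^2 and G.\<close>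
  define e where "e = (G - 2 * B^2) / (2 * G)"
  have "e > 0" using lt G by (simp add: e_def)
  then obtain h h1 h2 where h: "H02 h h1 h2" "integral {-1..1} (\<lambda>x. (h1 x)^2) \<le> 2" "(h 0)^2 \<ge> 1 - e"
    using H02_near_tent by metis
  have "B^2 * integral {-1..1} (\<lambda>x. (h1 x)^2) \<le> B^2 * 2" using h(2) by (intro mult_left_mono) auto
  also have "\<dots> < G * (1 - e)" using lt G by (simp add: e_def field_simps)
  also have "\<dots> \<le> G * (h 0)^2" using h(3) G by (intro mult_left_mono) auto
  finally show "X \<noteq> {}" using h(1) unfolding X_def by fastforce
  fix s assume "s \<in> X"
  then obtain psi d1 d2 where s: "s = B^2 * integral {-1..1} (\<lambda>x. (d2 x)^2) /
        (G * (psi 0)^2 - B^2 * integral {-1..1} (\<lambda>x. (d1 x)^2))" and H: "H02 psi d1 d2"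
      "G * (psi 0)^2 - B^2 * integral {-1..1} (\<lambda>x. (d1 x)^2) > 0" unfolding X_def by blast
  have "integral {-1..1} (\<lambda>x. (d2 x)^2) \<ge> 0" using H(1) H01_energy_nonneg unfolding H02_def by blast
  then show "0 \<le> s" unfolding s using H(2) by simp
qed

text \<open>The definition of the critical frequency with its denominator \<open>K\<close> cleared;
  where K <= 0 the inequality holds by sign alone. The right-hand side is
  \<open>energy 0\<close>.\<close>

lemma xi_vc_le:
  assumes G: "G > 0" and B: "\<bar>B\<bar> < Bcrit G" and xi: "\<bar>xi\<bar> \<le> xi_vc G B" and H: "H02 psi d1 d2"
  shows "xi^2 * (G * (psi 0)^2) \<le> B^2 * integral {-1..1} (\<lambda>x. (d2 x)^2) + B^2 * xi^2 * integral {-1..1} (\<lambda>x. (d1 x)^2)"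
proof -
  define X where "X = {B^2 * integral {-1..1} (\<lambda>x. (d2 x)^2) /
        (G * (psi 0)^2 - B^2 * integral {-1..1} (\<lambda>x. (d1 x)^2)) |
        psi d1 d2. H02 psi d1 d2 \<and> G * (psi 0)^2 - B^2 * integral {-1..1} (\<lambda>x. (d1 x)^2) > 0}"
  note bd = xi_vc_set_bounds[OF G B, folded X_def]
  define K where "K = G * (psi 0)^2 - B^2 * integral {-1..1} (\<lambda>x. (d1 x)^2)"
  define I2 where "I2 = integral {-1..1} (\<lambda>x. (d2 x)^2)"
  have I2: "I2 \<ge> 0" using H H01_energy_nonneg unfolding H02_def I2_def by blast
  have "xi^2 * K \<le> B^2 * I2"
  proof (cases "K > 0")
    case True
    then have m: "B^2 * I2 / K \<in> X" using H unfolding X_def K_def I2_def by blast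
    have "bdd_below X" using bd(2) by (intro bdd_belowI[of _ 0])
    then have le: "Inf X \<le> B^2 * I2 / K" using m by (intro cInf_lower)
    have nn: "Inf X \<ge> 0" using bd by (intro cInf_greatest) auto
    have "\<bar>xi\<bar> \<le> sqrt (Inf X)" using xi unfolding xi_vc_def X_def .
    then have "\<bar>xi\<bar>^2 \<le> (sqrt (Inf X))^2" by (intro power_mono) auto
    then have "xi^2 \<le> B^2 * I2 / K" using nn le by simp
    then show ?thesis using True by (simp add: field_simps)
  next
    case False
    then have "xi^2 * K \<le> 0" by (intro mult_nonneg_nonpos) auto
    also have "0 \<le> B^2 * I2" using I2 by simp
    finally show ?thesis .
  qed
  then show ?thesis unfolding K_def I2_def by (simp add: algebra_simps)
qed

text \<open>By definition of the infimum some admissible quotient lies below xi^2; no minimiser is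
  involved.\<close>

lemma xi_vc_less:
  assumes G: "G > 0" and B: "\<bar>B\<bar> < Bcrit G" and xi: "\<bar>xi\<bar> > xi_vc G B"
  obtains psi d1 d2 where "H02 psi d1 d2" "xi \<noteq> 0"
    "B^2 * integral {-1..1} (\<lambda>x. (d2 x)^2) + B^2 * xi^2 * integral {-1..1} (\<lambda>x. (d1 x)^2) < xi^2 * (G * (psi 0)^2)"
proof -
  define X where "X = {B^2 * integral {-1..1} (\<lambda>x. (d2 x)^2) /
        (G * (psi 0)^2 - B^2 * integral {-1..1} (\<lambda>x. (d1 x)^2)) |
        psi d1 d2. H02 psi d1 d2 \<and> G * (psi 0)^2 - B^2 * integral {-1..1} (\<lambda>x. (d1 x)^2) > 0}"
  note bd = xi_vc_set_bounds[OF G B, folded X_def]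
  have nn: "Inf X \<ge> 0" using bd by (intro cInf_greatest) auto
  have lt: "sqrt (Inf X) < \<bar>xi\<bar>" using xi unfolding xi_vc_def X_def .
  then have "Inf X < xi^2" using real_sqrt_less_iff[of "Inf X" "xi^2"] by simp
  then obtain s where "s \<in> X" "s < xi^2" using cInf_lessD[OF bd(1)] by blast
  then obtain psi d1 d2 where s: "B^2 * integral {-1..1} (\<lambda>x. (d2 x)^2) /
        (G * (psi 0)^2 - B^2 * integral {-1..1} (\<lambda>x. (d1 x)^2)) < xi^2" and H: "H02 psi d1 d2"
      "G * (psi 0)^2 - B^2 * integral {-1..1} (\<lambda>x. (d1 x)^2) > 0" unfolding X_def by blast
  have "B^2 * integral {-1..1} (\<lambda>x. (d2 x)^2) < xi^2 * (G * (psi 0)^2 - B^2 * integral {-1..1} (\<lambda>x. (d1 x)^2))"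
    using s H(2) by (simp add: pos_divide_less_eq)
  moreover have "xi \<noteq> 0" using lt nn by auto
  ultimately show ?thesis using that[OF H(1)] by (simp add: algebra_simps)
qed

section \<open>From the transmission problem back to the eigenvalue problem\<close>

context rayleigh_taylor
begin

lemma is_solutionE:
  assumes "is_solution g rp rm mp mm B xi lm psi"
  obtains Dm Dp where "transmission lm (g * (rp - rm) * xi^2 * psi 0) Dm Dp"
    "\<And>x. x \<in> {-1..1} \<Longrightarrow> psi x = glue Dm Dp 0 x"
proof -
  obtain Dm Dp where S: "C4_on (-1) 0 psi Dm" "C4_on 0 1 psi Dp"
      "\<forall>x\<in>{-1<..<0}. ode_res rm mm B xi lm (\<lambda>k. Dm k x)"
      "\<forall>x\<in>{0<..<1}. ode_res rp mp B xi lm (\<lambda>k. Dp k x)"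
      "Dp 0 0 - Dm 0 0 = 0" "Dp 1 0 - Dm 1 0 = 0"
      "(mp * lm * (xi^2 * Dp 0 0 + Dp 2 0) + \<bar>B\<bar>^2 * Dp 2 0)
        - (mm * lm * (xi^2 * Dm 0 0 + Dm 2 0) + \<bar>B\<bar>^2 * Dm 2 0) = 0"
      "(mp * lm * (Dp 3 0 - 3 * xi^2 * Dp 1 0) + \<bar>B\<bar>^2 * Dp 3 0)
        - (mm * lm * (Dm 3 0 - 3 * xi^2 * Dm 1 0) + \<bar>B\<bar>^2 * Dm 3 0)
        = (lm^2 * rp * Dp 1 0 - lm^2 * rm * Dm 1 0) + g * (rp - rm) * xi^2 * psi 0"
      "psi (-1) = 0" "psi 1 = 0" "Dm 1 (-1) = 0" "Dp 1 1 = 0"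
    using assms unfolding is_solution_def by blast
  have v: "Dm 0 x = psi x" if "x \<in> {-1..0}" for x using S(1) that unfolding C4_on_def by blast
  have w: "Dp 0 x = psi x" if "x \<in> {0..1}" for x using S(2) that unfolding C4_on_def by blast
  show ?thesis
  proof (rule that)
    have b: "Dm 0 (-1) = 0" "Dp 0 1 = 0" using v[of "-1"] w[of 1] S(9,10) by simp_all
    show "transmission lm (g * (rp - rm) * xi^2 * psi 0) Dm Dp"
      unfolding transmission_def
    proof (intro conjI)
      show "(mp * lm * (Dp 3 0 - 3 * xi^2 * Dp 1 0) + B^2 * Dp 3 0)
       - (mm * lm * (Dm 3 0 - 3 * xi^2 * Dm 1 0) + B^2 * Dm 3 0)
       - (lm^2 * rp * Dp 1 0 - lm^2 * rm * Dm 1 0) = g * (rp - rm) * xi^2 * psi 0"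
        using S(8) unfolding power2_abs by linarith
      show "(mp * lm * (xi^2 * Dp 0 0 + Dp 2 0) + B^2 * Dp 2 0)
        - (mm * lm * (xi^2 * Dm 0 0 + Dm 2 0) + B^2 * Dm 2 0) = 0"
        using S(7) unfolding power2_abs .
    qed (use S(1-6) S(11,12) b in \<open>unfold C4_on_def, blast+\<close>)
    show "psi x = glue Dm Dp 0 x" if "x \<in> {-1..1}" for x
      using that v[of x] w[of x] by (auto simp: glue_def)
  qed
qed

lemma is_solutionI:
  assumes T: "transmission lm (g * (rp - rm) * xi^2 * Dm 0 0) Dm Dp"
  shows "is_solution g rp rm mp mm B xi lm (glue Dm Dp 0)"
proof -
  note T = T[unfolded transmission_def]
  have e: "Dp 0 0 = Dm 0 0" using T by simp
  have b: "glue Dm Dp 0 0 = Dm 0 0" "glue Dm Dp 0 (-1) = 0" "glue Dm Dp 0 1 = 0"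
    using T by (auto simp: glue_def)
  show ?thesis unfolding is_solution_def
  proof (rule exI[of _ Dm], rule exI[of _ Dp], intro conjI)
    have "Dm 0 x = glue Dm Dp 0 x" if "x \<in> {-1..0}" for x using that by (simp add: glue_def)
    then show "C4_on (-1) 0 (glue Dm Dp 0) Dm" using T unfolding C4_on_def by blast
    have "Dp 0 x = glue Dm Dp 0 x" if "x \<in> {0..1}" for x using that e by (auto simp: glue_def)
    then show "C4_on 0 1 (glue Dm Dp 0) Dp" using T unfolding C4_on_def by blast
    show "(mp * lm * (xi^2 * Dp 0 0 + Dp 2 0) + \<bar>B\<bar>^2 * Dp 2 0)
        - (mm * lm * (xi^2 * Dm 0 0 + Dm 2 0) + \<bar>B\<bar>^2 * Dm 2 0) = 0"
      using T unfolding power2_abs by blast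
    show "(mp * lm * (Dp 3 0 - 3 * xi^2 * Dp 1 0) + \<bar>B\<bar>^2 * Dp 3 0)
        - (mm * lm * (Dm 3 0 - 3 * xi^2 * Dm 1 0) + \<bar>B\<bar>^2 * Dm 3 0)
        = (lm^2 * rp * Dp 1 0 - lm^2 * rm * Dm 1 0) + g * (rp - rm) * xi^2 * glue Dm Dp 0 0"
      using T unfolding power2_abs b by linarith
  qed (use T b in blast)+
qed

text \<open>The hypothesis on all of H_0^2 is the common form of cases (i) and (ii): buoyancy never
  exceeds the magnetic energy. It is applied to the solution itself.\<close>

lemma solution_trivial:
  assumes S: "is_solution g rp rm mp mm B xi lm psi" and lm: "lm > 0"
    and le: "\<And>h h1 h2. H02 h h1 h2 \<Longrightarrow> xi^2 * (g * (rp - rm) * (h 0)^2)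
      \<le> B^2 * integral {-1..1} (\<lambda>x. (h2 x)^2) + B^2 * xi^2 * integral {-1..1} (\<lambda>x. (h1 x)^2)"
  shows "\<not> nonzero_on psi"
proof -
  obtain Dm Dp where T: "transmission lm (g * (rp - rm) * xi^2 * psi 0) Dm Dp"
    and e: "\<And>x. x \<in> {-1..1} \<Longrightarrow> psi x = glue Dm Dp 0 x" using is_solutionE[OF S] by metis
  note H = H02_glue[OF T]
  have p0: "psi 0 = Dm 0 0" "glue Dm Dp 0 0 = Dm 0 0" using e[of 0] by (simp_all add: glue_def)
  have "energy lm (glue Dm Dp 0) (glue Dm Dp 1) (glue Dm Dp 2) \<le> energy 0 (glue Dm Dp 0) (glue Dm Dp 1) (glue Dm Dp 2)"
    using le[OF H] unfolding energy_transmission[OF T] energy_lower(2)[OF H order_refl] p0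
    by (simp add: power2_eq_square algebra_simps)
  then have "glue Dm Dp 0 x = 0" if "x \<in> {-1..1}" for x using energy_zeroD[OF H lm _ that] by blast
  then show ?thesis unfolding nonzero_on_def using e by simp
qed

lemma solution_exists:
  assumes g: "g > 0" and B: "\<bar>B\<bar> < Bcrit (g * (rp - rm))" and xi: "\<bar>xi\<bar> > xi_vc (g * (rp - rm)) B"
  shows "\<exists>lm psi. lm > 0 \<and> is_solution g rp rm mp mm B xi lm psi \<and>
    smooth_on {-1<..<0} psi \<and> smooth_on {0<..<1} psi \<and> psi 0 \<noteq> 0"
proof -
  have G: "g * (rp - rm) > 0" using g rp_gt by simp
  obtain h h1 h2 where h: "H02 h h1 h2" "xi \<noteq> 0"
    "B^2 * integral {-1..1} (\<lambda>x. (h2 x)^2) + B^2 * xi^2 * integral {-1..1} (\<lambda>x. (h1 x)^2)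
      < xi^2 * (g * (rp - rm) * (h 0)^2)" using xi_vc_less[OF G B xi] by metis
  have "g * (rp - rm) * xi^2 > 0" using G h(2) by simp
  moreover have "energy 0 h h1 h2 < g * (rp - rm) * xi^2 * (h 0)^2"
    using h(3) unfolding energy_lower(2)[OF h(1) order_refl] by (simp add: algebra_simps)
  ultimately obtain lm Dm Dp where lm: "lm > 0" and T: "transmission lm 1 Dm Dp"
    and k: "g * (rp - rm) * xi^2 * Dm 0 0 = 1"
    and d: "\<And>k x. (Dm k has_real_derivative Dm (Suc k) x) (at x)"
      "\<And>k x. (Dp k has_real_derivative Dp (Suc k) x) (at x)"
    using eigenvalue_exists[OF h(1)] by metis
  \<comment> \<open>The equation \<open>k\<close> says that the prescribed jump 1 equals g [rho]
    xi^2 psi(0).\<close>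
  have "is_solution g rp rm mp mm B xi lm (glue Dm Dp 0)" using T k by (intro is_solutionI) simp
  moreover have "smooth_on {-1<..<0} (glue Dm Dp 0)"
    unfolding smooth_on_def by (rule exI[of _ Dm]) (use d in \<open>auto simp: glue_def\<close>)
  moreover have "smooth_on {0<..<1} (glue Dm Dp 0)"
    unfolding smooth_on_def by (rule exI[of _ Dp]) (use d in \<open>auto simp: glue_def\<close>)
  moreover have "glue Dm Dp 0 0 \<noteq> 0" using k by (auto simp: glue_def)
  ultimately show ?thesis using lm by blast
qed

end

text \<open>Only even powers of \<open>xi\<close> occur, so the family can be made even by choosing
  it at |xi|.\<close>

lemma is_solution_abs:
  "is_solution g rp rm mp mm B \<bar>xi\<bar> lm psi = is_solution g rp rm mp mm B xi lm psi"
  unfolding is_solution_def ode_res_def by simp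

theorem theorem2p1:
  fixes g rp rm mp mm B :: real
  assumes "g > 0" and "rp > rm" and "rm > 0" and "mp > 0" and "mm > 0" and "B \<noteq> 0"
  shows
    "(\<bar>B\<bar> \<ge> Bcrit (g * (rp - rm)) \<longrightarrow>
        (\<forall>xi lm psi. lm > 0 \<and> is_solution g rp rm mp mm B xi lm psi \<longrightarrow> \<not> nonzero_on psi))
     \<and> (\<bar>B\<bar> < Bcrit (g * (rp - rm)) \<longrightarrow>
        (\<forall>xi lm psi. \<bar>xi\<bar> \<le> xi_vc (g * (rp - rm)) B \<and> lm > 0 \<and>
            is_solution g rp rm mp mm B xi lm psi \<longrightarrow> \<not> nonzero_on psi))
     \<and> (\<bar>B\<bar> < Bcrit (g * (rp - rm)) \<longrightarrow>
        (\<exists>Lm :: real \<Rightarrow> real. \<exists>Psi :: real \<Rightarrow> real \<Rightarrow> real.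
          \<forall>xi. \<bar>xi\<bar> > xi_vc (g * (rp - rm)) B \<longrightarrow>
            Lm xi > 0 \<and> is_solution g rp rm mp mm B xi (Lm xi) (Psi xi) \<and>
            Lm (- xi) = Lm xi \<and> Psi (- xi) = Psi xi \<and>
            smooth_on {-1<..<0} (Psi xi) \<and> smooth_on {0<..<1} (Psi xi) \<and>
            Psi xi 0 \<noteq> 0))"
proof (intro conjI impI)
  have G: "g * (rp - rm) > 0" using assms by simp
  have rt: "rayleigh_taylor rp rm mp mm" by unfold_locales (use assms in auto)
  {
    assume B: "\<bar>B\<bar> \<ge> Bcrit (g * (rp - rm))"
    show "\<forall>xi lm psi. lm > 0 \<and> is_solution g rp rm mp mm B xi lm psi \<longrightarrow> \<not> nonzero_on psi"
    proof (intro allI impI, elim conjE)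
      fix xi lm psi assume lm: "lm > 0" and S: "is_solution g rp rm mp mm B xi lm psi"
      show "\<not> nonzero_on psi"
      proof (rule rayleigh_taylor.solution_trivial[OF rt S lm])
        \<comment> \<open>In case (i) the first-derivative part of the magnetic energy alone
          dominates; the second-derivative part is only nonnegative.\<close>
        fix h h1 h2 assume H: "H02 h h1 h2"
        then have 1: "g * (rp - rm) * (h 0)^2 \<le> B^2 * integral {-1..1} (\<lambda>x. (h1 x)^2)"
          and 2: "integral {-1..1} (\<lambda>x. (h2 x)^2) \<ge> 0"
          using Bcrit_le[OF G B] H01_energy_nonneg unfolding H02_def by blast+
        have "xi^2 * (g * (rp - rm) * (h 0)^2) \<le> xi^2 * (B^2 * integral {-1..1} (\<lambda>x. (h1 x)^2))"
          using 1 by (intro mult_left_mono) auto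
        moreover have "0 \<le> B^2 * integral {-1..1} (\<lambda>x. (h2 x)^2)" using 2 by simp
        ultimately show "xi^2 * (g * (rp - rm) * (h 0)^2) \<le> B^2 * integral {-1..1} (\<lambda>x. (h2 x)^2)
            + B^2 * xi^2 * integral {-1..1} (\<lambda>x. (h1 x)^2)" by (simp add: mult_ac)
      qed
    qed
  next
    assume B: "\<bar>B\<bar> < Bcrit (g * (rp - rm))"
    show "\<forall>xi lm psi. \<bar>xi\<bar> \<le> xi_vc (g * (rp - rm)) B \<and> lm > 0 \<and>
            is_solution g rp rm mp mm B xi lm psi \<longrightarrow> \<not> nonzero_on psi"
      using rayleigh_taylor.solution_trivial[OF rt] xi_vc_le[OF G B] by blast
  next
    assume B: "\<bar>B\<bar> < Bcrit (g * (rp - rm))"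
    have "\<exists>Lm Psi. \<forall>xi. \<bar>xi\<bar> > xi_vc (g * (rp - rm)) B \<longrightarrow> Lm xi > 0 \<and>
        is_solution g rp rm mp mm B xi (Lm xi) (Psi xi) \<and>
        smooth_on {-1<..<0} (Psi xi) \<and> smooth_on {0<..<1} (Psi xi) \<and> Psi xi 0 \<noteq> 0"
      using rayleigh_taylor.solution_exists[OF rt \<open>g > 0\<close> B] by metis
    then obtain Lm Psi where *: "\<And>xi. \<bar>xi\<bar> > xi_vc (g * (rp - rm)) B \<Longrightarrow> Lm xi > 0 \<and>
        is_solution g rp rm mp mm B xi (Lm xi) (Psi xi) \<and>
        smooth_on {-1<..<0} (Psi xi) \<and> smooth_on {0<..<1} (Psi xi) \<and> Psi xi 0 \<noteq> 0" by blast
    show "\<exists>Lm :: real \<Rightarrow> real. \<exists>Psi :: real \<Rightarrow> real \<Rightarrow> real.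
          \<forall>xi. \<bar>xi\<bar> > xi_vc (g * (rp - rm)) B \<longrightarrow>
            Lm xi > 0 \<and> is_solution g rp rm mp mm B xi (Lm xi) (Psi xi) \<and>
            Lm (- xi) = Lm xi \<and> Psi (- xi) = Psi xi \<and>
            smooth_on {-1<..<0} (Psi xi) \<and> smooth_on {0<..<1} (Psi xi) \<and>
            Psi xi 0 \<noteq> 0"
      by (rule exI[of _ "\<lambda>xi. Lm \<bar>xi\<bar>"], rule exI[of _ "\<lambda>xi. Psi \<bar>xi\<bar>"])
        (use *[of "\<bar>xi\<bar>" for xi] in \<open>simp add: is_solution_abs\<close>)
  }
qed

end
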